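(* Let $k=k(n)$ and $w=w(n)$ be integers such that $2kw\left(2w + \lceil \log k \rceil + \lceil \log 2w \rceil\right)<n$, $k\geq 2$ and $w\geq 64$. Then $\mathsf{k\text{-}OBDD}_{\lfloor w/16 \rfloor-3}\subsetneq\mathsf{k\text{-}OBDD}_{w}$.
   Context: Logarithms are base 2. A branching program over a set $X$ of $n$ Boolean variables is a directed acyclic graph with one source and sink nodes labeled $0$ or $1$; each inner node is labeled by a variable $x\in X$ and has two outgoing edges labeled $x=0$ and $x=1$. An input $\nu\in\{0,1\}^n$ determines a path from the source to a sink, and the program computes $f$ if the reached sink label equals $f(\nu)$ for every $\nu$. A branching program is leveled if its nodes are partitioned into levels $V_1,\dots,V_\ell$ and a level $V_{\ell+1}$ of sinks, with edges from $V_j$ going only to $V_{j+1}$; its width is $\max_{1\le j\le \ell}|V_j|$. It is oblivious if all inner nodes of a level are labeled by the same variable, and read once if each variable is tested at most once on each path. An OBDD is an oblivious leveled read-once branching program; its order is the sequence in which variables are tested. A $k$-OBDD with order $\theta$ is a leveled oblivious branching program consisting of $k$ consecutive layers, each of which is an OBDD with the same order $\theta$. $\mathsf{k\text{-}OBDD}_{w}$ denotes the set of Boolean functions (of $n$ variables) that can be represented by a $k$-OBDD of width $w$. *)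

theory Defs
  imports Complex_Main "HOL-Library.FuncSet" "HOL-Library.Disjoint_Sets"
begin

datatype 'x node_label = Inner 'x | Sink bool

text \<open>\<open>edge G u b\<close> is the head of the edge leaving \<open>u\<close> labelled \<open>x = b\<close>, where \<open>x\<close> is the
  variable tested at \<open>u\<close>. Its value is irrelevant if \<open>u\<close> is a sink.\<close>

record ('v, 'x) bp =
  nodes :: "'v set"
  label :: "'v \<Rightarrow> 'x node_label"
  edge :: "'v \<Rightarrow> bool \<Rightarrow> 'v"

definition arcs :: "('v, 'x) bp \<Rightarrow> ('v \<times> 'v) set" where
  "arcs G = {(u, edge G u b) | u b. u \<in> nodes G \<and> (\<exists>x. label G u = Inner x)}"

definition is_source :: "('v, 'x) bp \<Rightarrow> 'v \<Rightarrow> bool" where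
  "is_source G s \<longleftrightarrow> s \<in> nodes G \<and> (\<forall>u. (u, s) \<notin> arcs G)"

definition source :: "('v, 'x) bp \<Rightarrow> 'v" where
  "source G = (THE s. is_source G s)"

definition branching_program :: "'x set \<Rightarrow> ('v, 'x) bp \<Rightarrow> bool" where
  "branching_program X G \<longleftrightarrow>
     finite (nodes G) \<and>
     (\<forall>u\<in>nodes G. \<forall>x. label G u = Inner x \<longrightarrow> x \<in> X) \<and>
     arcs G \<subseteq> nodes G \<times> nodes G \<and>
     acyclic (arcs G) \<and>
     (\<exists>!s. is_source G s)"

text \<open>\<open>reaches_sink G \<nu> u b\<close>: the path that the input \<open>\<nu>\<close> determines from \<open>u\<close> ends in a sink
  labelled \<open>b\<close>.\<close>

inductive reaches_sink :: "('v, 'x) bp \<Rightarrow> ('x \<Rightarrow> bool) \<Rightarrow> 'v \<Rightarrow> bool \<Rightarrow> bool"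
  for G :: "('v, 'x) bp" and \<nu> :: "'x \<Rightarrow> bool" where
  sink: "label G u = Sink b \<Longrightarrow> reaches_sink G \<nu> u b"
| inner: "label G u = Inner x \<Longrightarrow> reaches_sink G \<nu> (edge G u (\<nu> x)) b \<Longrightarrow> reaches_sink G \<nu> u b"

text \<open>Inputs over the variable set \<open>X\<close>, and Boolean functions of the variables in \<open>X\<close>, are
  extensional functions, so that equality of such functions is equality of their values on the
  cube.\<close>

abbreviation inputs :: "'x set \<Rightarrow> ('x \<Rightarrow> bool) set" where
  "inputs X \<equiv> X \<rightarrow>\<^sub>E UNIV"

abbreviation boolean_functions :: "'x set \<Rightarrow> (('x \<Rightarrow> bool) \<Rightarrow> bool) set" where
  "boolean_functions X \<equiv> inputs X \<rightarrow>\<^sub>E UNIV"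

definition computes :: "'x set \<Rightarrow> ('v, 'x) bp \<Rightarrow> (('x \<Rightarrow> bool) \<Rightarrow> bool) \<Rightarrow> bool" where
  "computes X G f \<longleftrightarrow> (\<forall>\<nu>\<in>inputs X. reaches_sink G \<nu> (source G) (f \<nu>))"

text \<open>\<open>V 1, \<dots>, V l\<close> are the levels of inner nodes and \<open>V (l + 1)\<close> is the level of sinks; the
  values of \<open>V\<close> at other indices are irrelevant.\<close>

definition leveled :: "('v, 'x) bp \<Rightarrow> nat \<Rightarrow> (nat \<Rightarrow> 'v set) \<Rightarrow> bool" where
  "leveled G l V \<longleftrightarrow>
     nodes G = (\<Union>j\<in>{1..l+1}. V j) \<and>
     (\<forall>j\<in>{1..l+1}. V j \<noteq> {}) \<and>
     disjoint_family_on V {1..l+1} \<and>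
     (\<forall>u\<in>nodes G. u \<in> V (l+1) \<longleftrightarrow> (\<exists>b. label G u = Sink b)) \<and>
     (\<forall>j\<in>{1..l}. \<forall>u\<in>V j. \<forall>b. edge G u b \<in> V (j+1))"

text \<open>The \<open>0\<close> only gives the maximum a value in the degenerate case \<open>l = 0\<close>.\<close>

definition width :: "nat \<Rightarrow> (nat \<Rightarrow> 'v set) \<Rightarrow> nat" where
  "width l V = Max (insert 0 ((\<lambda>j. card (V j)) ` {1..l}))"

definition is_path :: "('v, 'x) bp \<Rightarrow> 'v list \<Rightarrow> bool" where
  "is_path G us \<longleftrightarrow>
     set us \<subseteq> nodes G \<and> (\<forall>i. Suc i < length us \<longrightarrow> (us ! i, us ! Suc i) \<in> arcs G)"

definition tested_variables :: "('v, 'x) bp \<Rightarrow> 'v list \<Rightarrow> 'x list" where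
  "tested_variables G us = [x. Inner x \<leftarrow> map (label G) us]"

definition read_once_on :: "('v, 'x) bp \<Rightarrow> 'v set \<Rightarrow> bool" where
  "read_once_on G S \<longleftrightarrow>
     (\<forall>us. is_path G us \<and> set us \<subseteq> S \<longrightarrow> distinct (tested_variables G us))"

text \<open>The levels \<open>V (a + 1), \<dots>, V (a + length \<theta>)\<close> form an OBDD with order \<open>\<theta>\<close>: all nodes of a
  level are labelled by the same variable, the variables are tested in the sequence \<open>\<theta>\<close>, and no
  path inside these levels tests a variable twice. The order need not mention every variable.
  Only the first layer of a \<open>k\<close>-OBDD begins in a single node, and only the last one ends in
  sinks, so these two conditions are imposed on the whole program and not on a layer.\<close>

definition obdd_layer ::
  "('v, 'x) bp \<Rightarrow> (nat \<Rightarrow> 'v set) \<Rightarrow> nat \<Rightarrow> 'x list \<Rightarrow> bool" where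
  "obdd_layer G V a \<theta> \<longleftrightarrow>
     (\<forall>j<length \<theta>. \<forall>u\<in>V (a + 1 + j). label G u = Inner (\<theta> ! j)) \<and>
     read_once_on G (\<Union>j<length \<theta>. V (a + 1 + j))"

definition k_obdd ::
  "'x set \<Rightarrow> nat \<Rightarrow> 'x list \<Rightarrow> ('v, 'x) bp \<Rightarrow> nat \<Rightarrow> (nat \<Rightarrow> 'v set) \<Rightarrow> bool" where
  "k_obdd X k \<theta> G l V \<longleftrightarrow>
     branching_program X G \<and> leveled G l V \<and>
     l = k * length \<theta> \<and> (\<forall>i<k. obdd_layer G V (i * length \<theta>) \<theta>)"

text \<open>As usual, ``of width \<open>w\<close>'' means of width at most \<open>w\<close>. Programs are finite, so natural
  numbers suffice as nodes.\<close>

definition k_OBDD :: "'x set \<Rightarrow> nat \<Rightarrow> nat \<Rightarrow> (('x \<Rightarrow> bool) \<Rightarrow> bool) set" where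
  "k_OBDD X k w =
     {f \<in> boolean_functions X.
        \<exists>(G :: (nat, 'x) bp) l V \<theta>. k_obdd X k \<theta> G l V \<and> width l V \<le> w \<and> computes X G f}"

end

theory Submission
  imports Defs
begin

text \<open>A \<open>k\<close>-OBDD of width \<open>W\<close> whose order is cut into \<open>A\<close> followed by its complement depends on
  the variables in \<open>A\<close> only through at most \<open>W ^ ((k - 1) * W + 1)\<close> transition tables. The
  separating function is a pointer jumping function with \<open>k\<close> rounds on a pointer with \<open>2 * m\<close>
  values, \<open>m = w div 16\<close>. Its input consists of blocks, each holding an address (round,
  pointer value) and a unary value; in each round the blocks are scanned in their fixed order,
  and a block whose address equals (round, current pointer) replaces the pointer by its value.
  One layer per round suffices to evaluate this in width \<open>4 * m\<close>.

  Since addresses are part of the input, they can be chosen after the order of a competing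
  program. Cut that order so that exactly half of the blocks have most of their value bits in
  \<open>A\<close>. Then among the first half of the blocks and the second half one finds enough blocks of
  opposite kinds, so that every round can be made to read one table entry owned by \<open>A\<close> and one
  owned by the complement, always in the same order. The tables owned by \<open>A\<close>, up to two
  reserved entries, are then pairwise distinguishable, which gives
  \<open>m ^ ((k - 1) * (m - 2))\<close> different subfunctions; this is too many for \<open>W = m - 3\<close>.\<close>

section \<open>From automata to \<open>k\<close>-OBDDs\<close>

lemma k_OBDD_mono:
  assumes "w \<le> w'"
  shows "k_OBDD X k w \<subseteq> k_OBDD X k w'"
proof
  fix f assume "f \<in> k_OBDD X k w"
  then obtain G :: "(nat, 'a) bp" and l V \<theta> where "f \<in> boolean_functions X"
    "k_obdd X k \<theta> G l V" "width l V \<le> w" "computes X G f"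
    unfolding k_OBDD_def mem_Collect_eq by (elim conjE exE)
  moreover from this have "width l V \<le> w'" using assms by linarith
  ultimately show "f \<in> k_OBDD X k w'"
    unfolding k_OBDD_def mem_Collect_eq by (intro conjI exI)
qed

lemma tested_variables_eq: "map (label G) us = map Inner xs \<Longrightarrow> tested_variables G us = xs"
proof -
  have "concat (map (\<lambda>y. case y of Inner x \<Rightarrow> [x] | Sink b \<Rightarrow> []) (map Inner xs)) = xs" for xs :: "'a list"
    by (induction xs) auto
  thus "map (label G) us = map Inner xs \<Longrightarrow> tested_variables G us = xs"
    unfolding tested_variables_def by metis
qed

text \<open>Time \<open>t\<close> runs through all layers, so \<open>\<delta>\<close> may depend on
  the round, while the tested variables repeat with period \<open>length \<theta>\<close>.\<close>

primrec automaton_state ::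
  "(nat \<Rightarrow> 's \<Rightarrow> bool \<Rightarrow> 's) \<Rightarrow> 'x list \<Rightarrow> 's \<Rightarrow> ('x \<Rightarrow> bool) \<Rightarrow> nat \<Rightarrow> 's" where
  "automaton_state \<delta> \<theta> s \<nu> 0 = s"
| "automaton_state \<delta> \<theta> s \<nu> (Suc t) =
     \<delta> t (automaton_state \<delta> \<theta> s \<nu> t) (\<nu> (\<theta> ! (t mod length \<theta>)))"

text \<open>Bits are chosen freely at each step. Thus every reachable state after time 0 is the head
  of an arc, and the start remains the only source.\<close>

primrec reachable :: "(nat \<Rightarrow> 's \<Rightarrow> bool \<Rightarrow> 's) \<Rightarrow> 's \<Rightarrow> nat \<Rightarrow> 's set" where
  "reachable \<delta> s 0 = {s}"
| "reachable \<delta> s (Suc t) = (\<Union>r\<in>reachable \<delta> s t. range (\<delta> t r))"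

lemma automaton_state_reachable: "automaton_state \<delta> \<theta> s \<nu> t \<in> reachable \<delta> s t"
  by (induction t) auto

lemma reachable_nonempty: "reachable \<delta> s t \<noteq> {}"
  by (induction t) auto

lemma distinct_map_path:
  fixes h :: "'v \<Rightarrow> nat"
  assumes "is_path G us" and "\<And>u v. (u, v) \<in> arcs G \<Longrightarrow> u \<in> nodes G \<Longrightarrow> h u < h v"
  shows "distinct (map h us)"
proof -
  have "sorted_wrt (<) (map h us)"
    unfolding sorted_wrt_iff_nth_Suc_transp[OF transp_on_less]
    using assms unfolding is_path_def by (auto intro!: assms(2))
  thus ?thesis
    using strict_sorted_iff by blast
qed

text \<open>Unroll the automaton in time: level \<open>t + 1\<close> holds the states reachable at
  time \<open>t\<close>, so its size is at most \<open>card S\<close>.\<close>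

lemma k_OBDD_automaton:
  fixes \<delta> :: "nat \<Rightarrow> 's \<Rightarrow> bool \<Rightarrow> 's" and X :: "'x set"
  assumes "finite S" and "card S \<le> w" and "s0 \<in> S"
    and closed: "\<And>t s b. s \<in> S \<Longrightarrow> \<delta> t s b \<in> S"
    and "distinct \<theta>" and "set \<theta> \<subseteq> X" and f: "f \<in> boolean_functions X"
    and acc: "\<And>\<nu>. \<nu> \<in> inputs X \<Longrightarrow> f \<nu> = acc (automaton_state \<delta> \<theta> s0 \<nu> (k * length \<theta>))"
  shows "f \<in> k_OBDD X k w"
proof -
  obtain e :: "'s \<Rightarrow> nat" where e: "inj_on e S" "e ` S \<subseteq> {..<w}"
    using assms(1,2) by (metis card_lessThan card_le_inj finite_lessThan)
  define d where "d = inv_into S e"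
  have d: "d (e s) = s" if "s \<in> S" for s
    using that e(1) by (simp add: d_def)
  have ew: "e s < w" if "s \<in> S" for s using that e(2) by auto
  have w: "w > 0" using ew[OF \<open>s0 \<in> S\<close>] by simp
  let ?N = "length \<theta>"
  define l where "l = k * ?N"
  let ?R = "reachable \<delta> s0"
  have RS: "?R t \<subseteq> S" for t
    by (induction t) (use closed \<open>s0 \<in> S\<close> in auto)
  \<comment> \<open>Time and state share one natural number; since \<open>e s < w\<close>,
    \<open>div w\<close> and \<open>mod w\<close> recover them.\<close>
  define node where "node = (\<lambda>t s. t * w + e s)"
  have node_div: "node t s div w = t" and node_mod: "d (node t s mod w) = s" if "s \<in> S" for t s
    using that ew[OF that] d[OF that] w by (simp_all add: node_def)
  define V where "V = (\<lambda>j. node (j - 1) ` ?R (j - 1))"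
  define G :: "(nat, 'x) bp" where "G = \<lparr>nodes = (\<Union>j\<in>{1..l+1}. V j),
     label = (\<lambda>u. if u div w < l then Inner (\<theta> ! (u div w mod ?N)) else Sink (acc (d (u mod w)))),
     edge = (\<lambda>u b. node (Suc (u div w)) (\<delta> (u div w) (d (u mod w)) b))\<rparr>"
  have nodes_iff: "u \<in> nodes G \<longleftrightarrow> (\<exists>t s. t \<le> l \<and> s \<in> ?R t \<and> u = node t s)" for u
  proof
    assume "u \<in> nodes G"
    then obtain j where "j \<in> {1..l+1}" "u \<in> V j" by (auto simp: G_def)
    thus "\<exists>t s. t \<le> l \<and> s \<in> ?R t \<and> u = node t s"
      by (auto simp: V_def intro!: exI[of _ "j - 1"])
  next
    assume "\<exists>t s. t \<le> l \<and> s \<in> ?R t \<and> u = node t s"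
    then obtain t s where "t \<le> l" "s \<in> ?R t" "u = node t s" by auto
    thus "u \<in> nodes G"
      by (auto simp: G_def V_def intro!: bexI[of _ "Suc t"])
  qed
  have label_node: "label G (node t s) = (if t < l then Inner (\<theta> ! (t mod ?N)) else Sink (acc s))"
    and edge_node: "edge G (node t s) b = node (Suc t) (\<delta> t s b)" if "s \<in> ?R t" for t s b
    using that RS[of t] node_div[of s t] node_mod[of s t] by (auto simp: G_def)
  have arcsE: "\<exists>t s b. t < l \<and> s \<in> ?R t \<and> u = node t s \<and> v = node (Suc t) (\<delta> t s b)"
    if uv: "(u, v) \<in> arcs G" for u v
  proof -
    from uv obtain b x where *: "u \<in> nodes G" "label G u = Inner x" "v = edge G u b"
      by (auto simp: arcs_def)
    then obtain t s where ts: "t \<le> l" "s \<in> ?R t" "u = node t s" using nodes_iff by blast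
    hence "t < l" using * label_node[of s t] by (auto split: if_splits)
    thus ?thesis using ts * edge_node[of s t] by blast
  qed
  have arcsI: "(node t s, node (Suc t) (\<delta> t s b)) \<in> arcs G" if "t < l" "s \<in> ?R t" for t s b
  proof -
    have "node t s \<in> nodes G" using that nodes_iff less_imp_le_nat by blast
    thus ?thesis unfolding arcs_def using that label_node[of s t] edge_node[of s t b]
      by (intro CollectI exI[of _ "node t s"] exI[of _ b]) simp
  qed
  have RSuc: "\<delta> t s b \<in> ?R (Suc t)" if "s \<in> ?R t" for t s b using that by auto
  have arcs_time: "v div w = Suc (u div w)" if uv: "(u, v) \<in> arcs G" for u v
  proof -
    obtain t s b where *: "s \<in> ?R t" "u = node t s" "v = node (Suc t) (\<delta> t s b)"
      using arcsE[OF uv] by blast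
    thus ?thesis using node_div RS[of t] closed by (metis subsetD)
  qed
  have acyc: "acyclic (arcs G)"
  proof (rule acyclic_subset[OF wf_acyclic[OF wf_less_than]])
    show "arcs G \<subseteq> less_than"
    proof (rule subrelI)
      fix u v assume "(u, v) \<in> arcs G"
      from arcs_time[OF this] have "\<not> v div w \<le> u div w" by simp
      hence "u < v" using div_le_mono leI by blast
      thus "(u, v) \<in> less_than" by simp
    qed
  qed
  have src: "is_source G (node 0 s0)"
    unfolding is_source_def
  proof (intro conjI allI notI)
    show "node 0 s0 \<in> nodes G" unfolding nodes_iff by (intro exI[of _ 0] exI[of _ s0]) simp
    fix u assume "(u, node 0 s0) \<in> arcs G"
    from arcs_time[OF this] show False using node_div[OF \<open>s0 \<in> S\<close>, of 0] by simp
  qed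
  have src_unique: "u = node 0 s0" if u: "is_source G u" for u
  proof -
    obtain t s where ts: "t \<le> l" "s \<in> ?R t" "u = node t s"
      using u nodes_iff by (auto simp: is_source_def)
    show ?thesis
    proof (cases t)
      case 0 thus ?thesis using ts by simp
    next
      case (Suc t')
      then obtain r b where "r \<in> ?R t'" "s = \<delta> t' r b" using ts by auto
      hence "(node t' r, u) \<in> arcs G" using arcsI[of t' r b] ts Suc by auto
      thus ?thesis using u by (auto simp: is_source_def)
    qed
  qed
  have source: "source G = node 0 s0"
    unfolding source_def using src src_unique by blast
  have inner_X: "x \<in> X" if u: "u \<in> nodes G" "label G u = Inner x" for u x
  proof -
    obtain t s where ts: "t \<le> l" "s \<in> ?R t" "u = node t s" using nodes_iff u(1) by blast
    hence "t < l" "x = \<theta> ! (t mod ?N)" using u(2) label_node[of s t] by (auto split: if_splits)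
    moreover have "?N > 0" using \<open>t < l\<close> by (cases "?N = 0") (auto simp: l_def)
    ultimately show ?thesis using \<open>set \<theta> \<subseteq> X\<close> by (meson mod_less_divisor nth_mem subsetD)
  qed
  have fin: "finite (nodes G)"
    using finite_subset[OF RS \<open>finite S\<close>] by (auto simp: G_def V_def)
  have bp: "branching_program X G"
    unfolding branching_program_def
  proof (intro conjI ballI allI impI)
    show "arcs G \<subseteq> nodes G \<times> nodes G"
    proof (rule subrelI)
      fix u v assume "(u, v) \<in> arcs G"
      from arcsE[OF this] obtain t s b where
        "t < l" "s \<in> ?R t" "u = node t s" "v = node (Suc t) (\<delta> t s b)" by blast
      moreover from this have "u \<in> nodes G" unfolding nodes_iff
        by (intro exI[of _ t] exI[of _ s]) simp
      moreover from calculation have "v \<in> nodes G" unfolding nodes_iff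
        by (intro exI[of _ "Suc t"] exI[of _ "\<delta> t s b"]) (simp add: RSuc del: reachable.simps)
      ultimately show "(u, v) \<in> nodes G \<times> nodes G" by simp
    qed
  qed (use fin inner_X acyc src src_unique in blast)+
  have V_node: "\<exists>s. s \<in> ?R t \<and> u = node t s \<and> s \<in> S" if "u \<in> V (Suc t)" for u t
    using that RS[of t] by (auto simp: V_def)
  have V_time: "u div w = t" if "u \<in> V (Suc t)" for u t
    using V_node[OF that] node_div by auto
  have lev: "leveled G l V"
    unfolding leveled_def
  proof (intro conjI ballI allI)
    show "nodes G = (\<Union>j\<in>{1..l+1}. V j)" by (simp add: G_def)
    show "V j \<noteq> {}" for j by (simp add: V_def reachable_nonempty)
    show "disjoint_family_on V {1..l+1}"
    proof (unfold disjoint_family_on_def, intro ballI impI)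
      fix i j assume "i \<in> {1..l+1}" "j \<in> {1..l+1}" "i \<noteq> j"
      moreover have "i = j" if "u \<in> V i" "u \<in> V j" for u
        using V_time[of u "i - 1"] V_time[of u "j - 1"] that calculation by (cases i; cases j) auto
      ultimately show "V i \<inter> V j = {}" by blast
    qed
  next
    fix u assume "u \<in> nodes G"
    then obtain t s where ts: "t \<le> l" "s \<in> ?R t" "u = node t s" using nodes_iff by blast
    have "u \<in> V (l + 1) \<longleftrightarrow> t = l"
    proof
      assume "u \<in> V (l + 1)"
      thus "t = l" using V_time[of u l] node_div[of s t] ts RS[of t] by auto
    next
      assume "t = l" thus "u \<in> V (l + 1)" using ts by (auto simp: V_def)
    qed
    also have "\<dots> \<longleftrightarrow> (\<exists>b. label G u = Sink b)" using ts label_node[of s t] by auto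
    finally show "u \<in> V (l + 1) \<longleftrightarrow> (\<exists>b. label G u = Sink b)" .
  next
    fix j u b assume j: "j \<in> {1..l}" and "u \<in> V j"
    then obtain s where "s \<in> ?R (j - 1)" "u = node (j - 1) s" by (auto simp: V_def)
    thus "edge G u b \<in> V (j + 1)"
      using edge_node[of s "j - 1" b] RSuc[of s "j - 1" b] j
      by (auto simp: V_def simp del: reachable.simps)
  qed
  have V_label: "label G u = Inner (\<theta> ! (t mod ?N))" if "u \<in> V (Suc t)" "t < l" for u t
    using V_node[OF that(1)] label_node that(2) by auto
  have lay: "obdd_layer G V (i * ?N) \<theta>" if "i < k" for i
  proof -
    have le: "i * ?N + j < l" if "j < ?N" for j
    proof -
      have "i * ?N + j < Suc i * ?N" using that by simp
      also have "\<dots> \<le> l" unfolding l_def using \<open>i < k\<close> by (intro mult_le_mono1) simp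
      finally show ?thesis .
    qed
    have lab: "label G u = Inner (\<theta> ! j)" if "j < ?N" "u \<in> V (i * ?N + 1 + j)" for u j
      using V_label[of u "i * ?N + j"] that le by simp
    moreover have "read_once_on G (\<Union>j<?N. V (i * ?N + 1 + j))"
      unfolding read_once_on_def
    proof (intro allI impI, elim conjE)
      fix us assume us: "is_path G us" "set us \<subseteq> (\<Union>j<?N. V (i * ?N + 1 + j))"
      let ?h = "\<lambda>u. u div w - i * ?N"
      have time: "\<exists>j<?N. u div w = i * ?N + j \<and> label G u = Inner (\<theta> ! j)"
        if u: "u \<in> set us" for u
      proof -
        obtain j where "j < ?N" "u \<in> V (i * ?N + 1 + j)" using us(2) u by auto
        thus ?thesis using lab V_time[of u "i * ?N + j"] by auto
      qed
      have "tested_variables G us = map (\<lambda>u. \<theta> ! ?h u) us"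
        by (rule tested_variables_eq) (use time in fastforce)
      also have "\<dots> = map ((!) \<theta>) (map ?h us)" by simp
      \<comment> \<open>Along a path the times, hence the offsets in the layer, are distinct, and
        \<open>\<theta>\<close> has no repetition.\<close>
      also have "distinct \<dots>"
      proof (subst distinct_map, intro conjI)
        have "distinct (map (\<lambda>u. u div w) us)"
          by (rule distinct_map_path[OF us(1)]) (use arcs_time in fastforce)
        thus "distinct (map ?h us)"
          using time by (auto simp: distinct_map inj_on_def; metis add_diff_cancel_left')
        have "set (map ?h us) \<subseteq> {..<?N}" using time by fastforce
        thus "inj_on ((!) \<theta>) (set (map ?h us))"
          using \<open>distinct \<theta>\<close> by (meson inj_on_nth inj_on_subset lessThan_iff subsetD)
      qed
      finally show "distinct (tested_variables G us)" .
    qed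
    ultimately show ?thesis by (auto simp: obdd_layer_def)
  qed
  have kobdd: "k_obdd X k \<theta> G l V" using bp lev lay by (simp add: k_obdd_def l_def)
  have "card (V j) \<le> w" for j
  proof -
    have "finite (?R (j - 1))" "card (?R (j - 1)) \<le> card S"
      using RS[of "j - 1"] \<open>finite S\<close> by (auto intro: finite_subset card_mono)
    thus ?thesis unfolding V_def using card_image_le \<open>card S \<le> w\<close> le_trans by metis
  qed
  hence wid: "width l V \<le> w" by (auto simp: width_def)
  have "computes X G f"
    unfolding computes_def source
  proof
    fix \<nu> assume \<nu>: "\<nu> \<in> inputs X"
    let ?st = "automaton_state \<delta> \<theta> s0 \<nu>"
    have "reaches_sink G \<nu> (node t (?st t)) (f \<nu>)" if "t \<le> l" for t
      using that
    proof (induction t rule: inc_induct)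
      case base
      show ?case
        using label_node[OF automaton_state_reachable, of l] acc[OF \<nu>]
        by (intro reaches_sink.sink) (simp add: l_def)
    next
      case (step t)
      note lb = label_node[OF automaton_state_reachable, of t \<theta> \<nu>]
        edge_node[OF automaton_state_reachable, of t \<theta> \<nu>]
      show ?case
        by (rule reaches_sink.inner[of _ _ "\<theta> ! (t mod ?N)"]) (use lb step in simp_all)
    qed
    thus "reaches_sink G \<nu> (node 0 s0) (f \<nu>)" by fastforce
  qed
  thus ?thesis using f kobdd wid unfolding k_OBDD_def by blast
qed

section \<open>The lower bound for \<open>k\<close>-OBDDs\<close>

lemma leveledD:
  assumes "leveled G l V"
  shows "nodes G = (\<Union>j\<in>{1..l+1}. V j)" and "j \<in> {1..l+1} \<Longrightarrow> V j \<noteq> {}"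
    and "disjoint_family_on V {1..l+1}"
    and "u \<in> nodes G \<Longrightarrow> u \<in> V (l+1) \<longleftrightarrow> (\<exists>b. label G u = Sink b)"
    and "j \<in> {1..l} \<Longrightarrow> u \<in> V j \<Longrightarrow> edge G u b \<in> V (j+1)"
  using assms unfolding leveled_def by blast+

lemma k_obdd_level_step:
  assumes "k_obdd X k \<theta> G l V" "i < k" "j < length \<theta>" "u \<in> V (i * length \<theta> + Suc j)"
  shows "label G u = Inner (\<theta> ! j)" and "edge G u b \<in> V (i * length \<theta> + Suc (Suc j))"
    and "u \<in> nodes G"
proof -
  have "i * length \<theta> + Suc j \<le> Suc i * length \<theta>" using assms by simp
  also have "\<dots> \<le> k * length \<theta>" using assms by (intro mult_le_mono1) simp
  finally have j: "i * length \<theta> + Suc j \<in> {1..l}" using assms by (simp add: k_obdd_def)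
  have lev: "leveled G l V" using assms(1) unfolding k_obdd_def by blast
  show "edge G u b \<in> V (i * length \<theta> + Suc (Suc j))" using leveledD(5)[OF lev j assms(4)] by simp
  have "i * length \<theta> + Suc j \<in> {1..l+1}" using j by simp
  thus "u \<in> nodes G" unfolding leveledD(1)[OF lev] using assms(4) by (rule UN_I)
  show "label G u = Inner (\<theta> ! j)"
    using assms by (auto simp: k_obdd_def obdd_layer_def)
qed

text \<open>Following \<open>False\<close> edges through the first layer gives a path that tests all
  of \<open>\<theta>\<close>; reading once then forbids a repetition.\<close>

lemma k_obdd_distinct:
  assumes obdd: "k_obdd X k \<theta> G l V" and "0 < k"
  shows "distinct \<theta>"
proof -
  have "V 1 \<noteq> {}" using obdd by (auto simp: k_obdd_def leveled_def)
  then obtain s where s: "s \<in> V 1" by blast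
  let ?p = "\<lambda>t. ((\<lambda>u. edge G u False) ^^ t) s"
  note st = k_obdd_level_step[OF obdd \<open>0 < k\<close>]
  have p: "?p t \<in> V (Suc t)" if "t \<le> length \<theta>" for t
    using that by (induction t) (use s st(2) in auto)
  hence lab: "label G (?p t) = Inner (\<theta> ! t)" and nod: "?p t \<in> nodes G" if "t < length \<theta>" for t
    using st(1,3)[OF that] that by auto
  let ?us = "map ?p [0..<length \<theta>]"
  have "is_path G ?us"
    unfolding is_path_def arcs_def using nod lab by (auto; metis Suc_lessD)
  moreover have "set ?us \<subseteq> (\<Union>j<length \<theta>. V (0 * length \<theta> + 1 + j))"
    using p less_imp_le_nat by auto
  moreover have "read_once_on G (\<Union>j<length \<theta>. V (0 * length \<theta> + 1 + j))"
    using obdd \<open>0 < k\<close> by (auto simp: k_obdd_def obdd_layer_def)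
  moreover have "tested_variables G ?us = \<theta>"
    by (rule tested_variables_eq, rule nth_equalityI) (use lab in auto)
  ultimately show ?thesis unfolding read_once_on_def by metis
qed

text \<open>With an empty order there is only the sink level, so the source is a sink. In this case
  there is no inner level at which to cut.\<close>

lemma k_obdd_empty_order:
  assumes "k_obdd X k [] G l V" "computes X G f" "\<nu> \<in> inputs X" "\<nu>' \<in> inputs X"
  shows "f \<nu> = f \<nu>'"
proof -
  have "is_source G (source G)"
    using assms(1) unfolding k_obdd_def branching_program_def source_def by (metis theI')
  hence "source G \<in> nodes G" by (simp add: is_source_def)
  moreover have lev: "leveled G 0 V" using assms(1) by (auto simp: k_obdd_def)
  moreover have "nodes G = V 1" using leveledD(1)[OF lev] by simp
  ultimately obtain b where "label G (source G) = Sink b"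
    using leveledD(4)[OF lev, of "source G"] by auto
  thus ?thesis using assms(2-4) unfolding computes_def
    by (metis node_label.distinct(1) node_label.inject(2) reaches_sink.cases)
qed

text \<open>Sinks are made fixed points, so that steps can be iterated without a side
  condition.\<close>

definition bp_step :: "('v, 'x) bp \<Rightarrow> ('x \<Rightarrow> bool) \<Rightarrow> 'v \<Rightarrow> 'v" where
  "bp_step G \<nu> u = (case label G u of Inner x \<Rightarrow> edge G u (\<nu> x) | Sink b \<Rightarrow> u)"

lemma reaches_sink_step: "reaches_sink G \<nu> u b \<Longrightarrow> reaches_sink G \<nu> (bp_step G \<nu> u) b"
  by (erule reaches_sink.cases) (auto simp: bp_step_def intro: reaches_sink.intros)

lemma reaches_sink_steps: "reaches_sink G \<nu> u b \<Longrightarrow> reaches_sink G \<nu> ((bp_step G \<nu> ^^ t) u) b"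
  by (induction t) (auto intro: reaches_sink_step)

lemma reaches_sink_Sink: "reaches_sink G \<nu> u b \<Longrightarrow> label G u = Sink c \<Longrightarrow> b = c"
  by (erule reaches_sink.cases) auto

text \<open>Arcs only enter levels from the second on, so each node of the first level is a source.
  This single node is why the first layer costs a factor \<open>W\<close> instead of
  \<open>W ^ W\<close>.\<close>

lemma level_one_source:
  assumes bp: "branching_program X G" and lev: "leveled G l V"
  shows "V 1 = {source G}"
proof -
  have "is_source G u" if u: "u \<in> V 1" for u
  proof -
    have "(v, u) \<notin> arcs G" for v
    proof
      assume a: "(v, u) \<in> arcs G"
      then obtain b x where v: "v \<in> nodes G" "label G v = Inner x" "u = edge G v b"
        by (auto simp: arcs_def)
      then obtain j where j: "j \<in> {1..l+1}" "v \<in> V j" unfolding leveledD(1)[OF lev] by blast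
      have "v \<notin> V (l+1)" using leveledD(4)[OF lev v(1)] v(2) by simp
      hence jl: "j \<in> {1..l}" using j by (cases "j = l + 1") auto
      hence "u \<in> V (j + 1)" using leveledD(5)[OF lev jl j(2)] v(3) by simp
      moreover have "V 1 \<inter> V (j + 1) = {}"
        by (rule disjoint_family_onD[OF leveledD(3)[OF lev]]) (use jl in auto)
      ultimately show False using u by blast
    qed
    moreover have "u \<in> nodes G" unfolding leveledD(1)[OF lev] using u by (intro UN_I[of 1]) simp_all
    ultimately show ?thesis by (simp add: is_source_def)
  qed
  moreover have "V 1 \<noteq> {}" using leveledD(2)[OF lev] by simp
  moreover have ex1: "\<exists>!s. is_source G s" using bp by (simp add: branching_program_def)
  ultimately show ?thesis
    unfolding source_def using the1_equality[OF ex1] by auto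
qed

text \<open>A fooling set for the cut into \<open>A\<close> and its complement: \<open>enc s\<close>
  fixes the part in \<open>A\<close>, while the common part outside may depend on the pair.\<close>

definition fooling_family ::
  "'x set \<Rightarrow> (('x \<Rightarrow> bool) \<Rightarrow> bool) \<Rightarrow> 'x set \<Rightarrow> 's set \<Rightarrow> ('s \<Rightarrow> 'x \<Rightarrow> bool) \<Rightarrow> bool" where
  "fooling_family X f A S enc \<longleftrightarrow> (\<forall>s\<in>S. \<forall>s'\<in>S. s \<noteq> s' \<longrightarrow>
     (\<exists>\<nu>\<in>inputs X. \<exists>\<nu>'\<in>inputs X. (\<forall>x\<in>A. \<nu> x = enc s x) \<and> (\<forall>x\<in>A. \<nu>' x = enc s' x) \<and>
        (\<forall>x. x \<notin> A \<longrightarrow> \<nu> x = \<nu>' x) \<and> f \<nu> \<noteq> f \<nu>'))"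

text \<open>A \<open>k\<close>-OBDD is a two-party protocol for the cut of its order at \<open>h\<close>: the variables in \<open>A\<close>
  enter only through the maps from the first level of a layer to its level at the cut.\<close>

lemma k_obdd_fooling_set:
  fixes enc :: "'s \<Rightarrow> 'x \<Rightarrow> bool"
  assumes obdd: "k_obdd X k \<theta> G l V" and wid: "width l V \<le> W" and comp: "computes X G f"
    and h: "h < length \<theta>" and A: "\<And>j. j < length \<theta> \<Longrightarrow> \<theta> ! j \<in> A \<longleftrightarrow> j < h" and "k > 0"
    and family: "fooling_family X f A S enc"
  shows "card S \<le> W ^ ((k - 1) * W + 1)"
proof -
  note fool = family[unfolded fooling_family_def, rule_format]
  let ?N = "length \<theta>"
  have bp: "branching_program X G" and lev: "leveled G l V" and l: "l = k * ?N"
    and lay: "\<And>i. i < k \<Longrightarrow> obdd_layer G V (i * ?N) \<theta>"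
    using obdd by (auto simp: k_obdd_def)
  have idx: "i * ?N + Suc j \<le> l" if "i < k" "j < ?N" for i j
  proof -
    have "i * ?N + Suc j \<le> Suc i * ?N" using that by simp
    also have "\<dots> \<le> l" unfolding l using that by (intro mult_le_mono1) simp
    finally show ?thesis .
  qed
  have fin: "finite (V j)" if "j \<in> {1..l+1}" for j
    using bp lev that unfolding branching_program_def leveled_def by (metis UN_upper finite_subset)
  have cardV: "card (V (i * ?N + Suc j)) \<le> W" "finite (V (i * ?N + Suc j))"
    if "i < k" "j < ?N" for i j
  proof -
    have "i * ?N + Suc j \<in> {1..l}" using idx[OF that] by simp
    hence "card (V (i * ?N + Suc j)) \<le> width l V" unfolding width_def by (intro Max_ge) auto
    thus "card (V (i * ?N + Suc j)) \<le> W" using wid by simp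
    show "finite (V (i * ?N + Suc j))" using fin idx[OF that] by auto
  qed
  have lab: "label G u = Inner (\<theta> ! j)" if "u \<in> V (i * ?N + Suc j)" "i < k" "j < ?N" for u i j
    using lay[OF that(2)] that by (auto simp: obdd_layer_def)
  have step: "bp_step G \<nu> u = edge G u (\<nu> (\<theta> ! j))"
    if "u \<in> V (i * ?N + Suc j)" "i < k" "j < ?N" for u i j \<nu>
    using lab[OF that] by (simp add: bp_step_def)
  have step_V: "bp_step G \<nu> u \<in> V (i * ?N + Suc (Suc j))"
    if "u \<in> V (i * ?N + Suc j)" "i < k" "j < ?N" for u i j \<nu>
    using step[OF that] idx[OF that(2,3)] leveledD(5)[OF lev _ that(1)] by simp
  have run: "(bp_step G \<nu> ^^ t) u \<in> V (i * ?N + Suc (j + t)) \<and>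
      ((\<forall>j'. j \<le> j' \<longrightarrow> j' < j + t \<longrightarrow> \<nu> (\<theta> ! j') = \<nu>' (\<theta> ! j')) \<longrightarrow>
       (bp_step G \<nu> ^^ t) u = (bp_step G \<nu>' ^^ t) u)"
    if "u \<in> V (i * ?N + Suc j)" "i < k" "j + t \<le> ?N" for u i j t \<nu> \<nu>'
    using that(3)
  proof (induction t)
    case 0 thus ?case using that by simp
  next
    case (Suc t)
    hence IH: "(bp_step G \<nu> ^^ t) u \<in> V (i * ?N + Suc (j + t))"
      and eq: "(\<forall>j'. j \<le> j' \<longrightarrow> j' < j + t \<longrightarrow> \<nu> (\<theta> ! j') = \<nu>' (\<theta> ! j')) \<longrightarrow>
       (bp_step G \<nu> ^^ t) u = (bp_step G \<nu>' ^^ t) u" by auto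
    have "j + t < ?N" using Suc by simp
    note * = step_V[OF IH \<open>i < k\<close> this, of \<nu>] step[OF IH \<open>i < k\<close> this, of \<nu>]
      step[OF IH \<open>i < k\<close> this, of \<nu>']
    show ?case using * eq by auto
  qed
  have runV: "(bp_step G \<nu> ^^ t) u \<in> V (i * ?N + Suc (j + t))"
    if "u \<in> V (i * ?N + Suc j)" "i < k" "j + t \<le> ?N" for u i j t \<nu>
    using run[OF that] by blast
  \<comment> \<open>The signature of an input: for every layer, its map from the first level to the
    cut. By \<open>h < length \<theta>\<close> the cut is a level of inner nodes and obeys the width
    bound.\<close>
  define sg where "sg = (\<lambda>\<sigma>. \<lambda>i\<in>{..<k}. \<lambda>u\<in>V (i * ?N + 1). (bp_step G \<sigma> ^^ h) u)"
  define T where "T = (\<Pi>\<^sub>E i\<in>{..<k}. V (i * ?N + 1) \<rightarrow>\<^sub>E V (i * ?N + Suc h))"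
  have N: "0 < ?N" using h by linarith
  have finT: "finite T"
    unfolding T_def using cardV(2)[OF _ N] cardV(2)[OF _ h] by (intro finite_PiE) auto
  have sgT: "sg \<sigma> \<in> T" for \<sigma>
  proof -
    have "(bp_step G \<sigma> ^^ h) u \<in> V (i * ?N + Suc h)" if "i < k" "u \<in> V (i * ?N + 1)" for i u
      using runV[of u i 0 h \<sigma>] that h by simp
    thus ?thesis by (auto simp: sg_def T_def)
  qed
  have W: "W > 0"
  proof -
    have "V (0 * ?N + Suc 0) \<noteq> {}" using lev by (auto simp: leveled_def)
    thus ?thesis using cardV[OF \<open>k > 0\<close> N] by (metis card_gt_0_iff less_le_trans)
  qed
  have "card T = (\<Prod>i<k. card (V (i * ?N + Suc h)) ^ card (V (i * ?N + 1)))"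
    unfolding T_def using cardV(2)[OF _ N] by (simp add: card_PiE)
  \<comment> \<open>Layer 0 starts in one node, so only one image has to be chosen there.\<close>
  also have "\<dots> \<le> (\<Prod>i<k. W ^ (if i = 0 then 1 else W))"
  proof (intro prod_mono conjI)
    fix i assume "i \<in> {..<k}"
    hence i: "i < k" by simp
    have "card (V (i * ?N + Suc h)) ^ card (V (i * ?N + 1)) \<le> W ^ card (V (i * ?N + 1))"
      using cardV[OF i h] by (intro power_mono) auto
    also have "\<dots> \<le> W ^ (if i = 0 then 1 else W)"
      using cardV[OF i N] W level_one_source[OF bp lev] by (intro power_increasing) auto
    finally show "card (V (i * ?N + Suc h)) ^ card (V (i * ?N + 1)) \<le> W ^ (if i = 0 then 1 else W)" .
  qed simp
  also have "\<dots> = W ^ (\<Sum>i<k. if i = 0 then 1 else W)" by (simp add: power_sum)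
  also have "(\<Sum>i<k. if i = 0 then 1 else W) = (k - 1) * W + 1"
    using \<open>k > 0\<close> by (cases k) (simp_all only: sum.lessThan_Suc_shift, simp_all)
  finally have cardT: "card T \<le> W ^ ((k - 1) * W + 1)" .
  have "inj_on (\<lambda>s. sg (enc s)) S"
  proof (rule inj_onI, rule ccontr)
    fix s s' assume ss: "s \<in> S" "s' \<in> S" "sg (enc s) = sg (enc s')" "s \<noteq> s'"
    from fool[OF ss(1,2,4)] obtain \<nu> \<nu>' where \<nu>: "\<nu> \<in> inputs X" "\<nu>' \<in> inputs X"
      "\<forall>x\<in>A. \<nu> x = enc s x" "\<forall>x\<in>A. \<nu>' x = enc s' x" "\<forall>x. x \<notin> A \<longrightarrow> \<nu> x = \<nu>' x" "f \<nu> \<noteq> f \<nu>'"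
      by blast
    \<comment> \<open>Both runs meet at every layer boundary: up to the cut the common signature
      decides, behind it the common values outside \<open>A\<close>.\<close>
    have ev: "(bp_step G \<nu> ^^ (i * ?N)) (source G) = (bp_step G \<nu>' ^^ (i * ?N)) (source G) \<and>
      (bp_step G \<nu> ^^ (i * ?N)) (source G) \<in> V (i * ?N + 1)" if "i \<le> k" for i
      using that
    proof (induction i)
      case 0 thus ?case using level_one_source[OF bp lev] by simp
    next
      case (Suc i)
      define u where "u = (bp_step G \<nu> ^^ (i * ?N)) (source G)"
      have u: "u = (bp_step G \<nu>' ^^ (i * ?N)) (source G)" "u \<in> V (i * ?N + Suc 0)" and i: "i < k"
        using Suc by (auto simp: u_def)
      have A': "\<theta> ! j \<in> A" if "j < h" for j using A[of j] that h by simp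
      have "(bp_step G \<nu> ^^ h) u = (bp_step G (enc s) ^^ h) u"
        using run[OF u(2) i, of h \<nu> "enc s"] h A' \<nu> by simp
      also have "\<dots> = (bp_step G (enc s') ^^ h) u"
        using fun_cong[OF fun_cong[OF ss(3)], of i u] i u by (simp add: sg_def)
      also have "\<dots> = (bp_step G \<nu>' ^^ h) u"
        using run[OF u(2) i, of h \<nu>' "enc s'"] h A' \<nu> by simp
      finally have eq: "(bp_step G \<nu> ^^ h) u = (bp_step G \<nu>' ^^ h) u" .
      have mid: "(bp_step G \<nu> ^^ h) u \<in> V (i * ?N + Suc h)" using runV[OF u(2) i, of h \<nu>] h by simp
      have eq2: "(bp_step G \<nu> ^^ (?N - h)) ((bp_step G \<nu> ^^ h) u)
        = (bp_step G \<nu>' ^^ (?N - h)) ((bp_step G \<nu> ^^ h) u)"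
        using run[OF mid i, of "?N - h" \<nu> \<nu>'] h A \<nu> by simp
      have split: "(bp_step G \<mu> ^^ (Suc i * ?N)) (source G) =
        (bp_step G \<mu> ^^ (?N - h)) ((bp_step G \<mu> ^^ h) ((bp_step G \<mu> ^^ (i * ?N)) (source G)))" for \<mu>
      proof -
        have "Suc i * ?N = (?N - h) + (h + i * ?N)" using h by simp
        thus ?thesis by (simp add: funpow_add del: mult_Suc)
      qed
      have "(bp_step G \<nu> ^^ (?N - h)) ((bp_step G \<nu> ^^ h) u) \<in> V (i * ?N + Suc ?N)"
        using runV[OF mid i, of "?N - h" \<nu>] h by simp
      moreover have "i * ?N + Suc ?N = Suc i * ?N + 1" by simp
      ultimately show ?case unfolding split using eq eq2 u u_def by (simp add: add.commute)
    qed
    define v where "v = (bp_step G \<nu> ^^ l) (source G)"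
    have v: "v = (bp_step G \<nu>' ^^ l) (source G)" "v \<in> V (l + 1)"
      using ev[of k] by (auto simp: v_def l)
    have "v \<in> nodes G" unfolding leveledD(1)[OF lev] using v(2) by (intro UN_I[of "l + 1"]) simp_all
    then obtain b where b: "label G v = Sink b" using leveledD(4)[OF lev] v(2) by blast
    have "reaches_sink G \<nu> v (f \<nu>)" "reaches_sink G \<nu>' v (f \<nu>')"
      using comp \<nu>(1,2) reaches_sink_steps[where t = l and u = "source G"] v(1)
      unfolding computes_def v_def by metis+
    thus False using b reaches_sink_Sink \<nu>(6) by metis
  qed
  moreover have "(\<lambda>s. sg (enc s)) ` S \<subseteq> T" using sgT by blast
  ultimately have "card S \<le> card T" using card_inj_on_le finT by blast
  thus ?thesis using cardT by simp
qed

section \<open>Pointer jumping\<close>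

lemma mult_add_eq_iff:
  fixes M :: nat
  assumes "c < M" "c' < M"
  shows "i * M + c = i' * M + c' \<longleftrightarrow> i = i' \<and> c = c'"
proof
  assume eq: "i * M + c = i' * M + c'"
  have "i = (i * M + c) div M" "c = (i * M + c) mod M" "i' = (i' * M + c') div M" "c' = (i' * M + c') mod M"
    using assms by simp_all
  thus "i = i' \<and> c = c'" using eq by metis
qed simp

lemma nat_eq_iff_low_bits:
  fixes a b :: nat
  assumes "a < 2 ^ n" "b < 2 ^ n"
  shows "(\<forall>j<n. bit a j = bit b j) \<longleftrightarrow> a = b"
proof
  assume "\<forall>j<n. bit a j = bit b j"
  hence "take_bit n a = take_bit n b" by (auto simp: bit_eq_iff bit_take_bit_iff)
  thus "a = b" using assms by (simp add: take_bit_nat_eq_self)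
qed simp

text \<open>If \<open>x\<close> elements of \<open>S\<close> lie in the lower half, then
  \<open>2 * K - x\<close> lie in the upper half, which therefore has \<open>x\<close> elements
  outside \<open>S\<close>. Distinguish \<open>x \<ge> K\<close> and
  \<open>x \<le> K\<close>.\<close>

lemma balanced_halves:
  fixes K :: nat
  assumes "S \<subseteq> {..<4 * K}" "card S = 2 * K"
  shows "K \<le> card (S \<inter> {..<2 * K}) \<and> K \<le> card ({2 * K..<4 * K} - S) \<or>
    K \<le> card ({..<2 * K} - S) \<and> K \<le> card (S \<inter> {2 * K..<4 * K})"
proof -
  have fin: "finite S" using assms(1) finite_subset by blast
  have "S = (S \<inter> {..<2 * K}) \<union> (S \<inter> {2 * K..<4 * K})" using assms(1) by auto
  hence "card S = card (S \<inter> {..<2 * K}) + card (S \<inter> {2 * K..<4 * K})"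
    using fin by (subst card_Un_disjoint[symmetric]) auto
  moreover have "card ({2 * K..<4 * K} - S) = 2 * K - card (S \<inter> {2 * K..<4 * K})"
    using card_Diff_subset_Int[of "{2 * K..<4 * K}" S] fin by (simp add: Int_commute)
  moreover have "card ({..<2 * K} - S) = 2 * K - card (S \<inter> {..<2 * K})"
    using card_Diff_subset_Int[of "{..<2 * K}" S] fin by (simp add: Int_commute)
  ultimately show ?thesis using assms(2) by linarith
qed

primrec iterate :: "(nat \<Rightarrow> nat \<Rightarrow> nat) \<Rightarrow> (nat \<Rightarrow> nat \<Rightarrow> nat) \<Rightarrow> nat \<Rightarrow> nat" where
  "iterate g h 0 = 0"
| "iterate g h (Suc i) = h i (g i (iterate g h i))"

text \<open>One scan of the blocks: pointer \<open>c\<close> is matched only at \<open>q1\<close>,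
  the new pointer \<open>c'\<close> only at the later \<open>q2\<close>, and the blocks matching
  \<open>c''\<close> have been passed by then.\<close>

lemma two_jumps:
  fixes s ad vl :: "nat \<Rightarrow> nat"
  assumes step: "\<And>q. q < Q \<Longrightarrow> s (Suc q) = (if ad q = n + s q then vl q else s q)"
    and "s 0 = c"
    and q1: "q1 < h" "ad q1 = n + c" "vl q1 = c'" "\<And>q. q < Q \<Longrightarrow> ad q = n + c \<Longrightarrow> q = q1"
    and q2: "h \<le> q2" "q2 < Q" "ad q2 = n + c'" "vl q2 = c''"
      "\<And>q. q < Q \<Longrightarrow> ad q = n + c' \<Longrightarrow> q = q2"
    and low: "\<And>q. q < Q \<Longrightarrow> ad q = n + c'' \<Longrightarrow> q < h"
  shows "s Q = c''"
proof -
  have "s q = c" if "q \<le> q1" for q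
    using that
  proof (induction q)
    case (Suc q)
    hence "q < Q" "s q = c" "q \<noteq> q1" using q1(1) q2(1,2) by simp_all
    thus ?case using step[of q] q1(4)[of q] by auto
  qed (use \<open>s 0 = c\<close> in simp)
  hence *: "s (Suc q1) = c'" using step[of q1] q1(1-3) q2(1,2) by simp
  have "s q = c'" if "Suc q1 \<le> q" "q \<le> q2" for q
    using that
  proof (induction q rule: dec_induct)
    case (step q)
    hence "q < Q" "s q = c'" "q \<noteq> q2" using q2(2) by simp_all
    thus ?case using assms(1)[of q] q2(5)[of q] by auto
  qed (rule *)
  hence **: "s (Suc q2) = c''" using step[of q2] q1(1) q2(1-4) by simp
  have "s q = c''" if "Suc q2 \<le> q" "q \<le> Q" for q
    using that
  proof (induction q rule: dec_induct)
    case (step q)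
    hence "q < Q" "s q = c''" "\<not> q < h" using q2(1) by simp_all
    thus ?case using assms(1)[of q] low[of q] by auto
  qed (rule **)
  thus ?thesis using q2(2) by simp
qed

text \<open>The common form of both cases of the cut: tables \<open>a\<close> on the side of
  \<open>A\<close> and maps \<open>b\<close> on the other side, where \<open>b\<close> has the first
  and the last word.\<close>

primrec alternating :: "(nat \<Rightarrow> nat \<Rightarrow> nat) \<Rightarrow> (nat \<Rightarrow> nat \<Rightarrow> nat) \<Rightarrow> nat \<Rightarrow> nat" where
  "alternating a b 0 = b 0 0"
| "alternating a b (Suc i) = b (Suc i) (a i (alternating a b i))"

text \<open>The fixed points \<open>0\<close> and \<open>1\<close> let the maps \<open>b\<close> carry a difference past the later maps \<open>a\<close>.\<close>

definition table :: "(nat \<times> nat \<Rightarrow> nat) \<Rightarrow> nat \<Rightarrow> nat \<Rightarrow> nat" where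
  "table a i c = (if c < 2 then c else a (i, c))"

definition tables :: "nat \<Rightarrow> nat \<Rightarrow> (nat \<times> nat \<Rightarrow> nat) set" where
  "tables r m = ({..<r} \<times> {2..<m}) \<rightarrow>\<^sub>E {..<m}"

lemma card_tables: "card (tables r m) = m ^ (r * (m - 2))"
  by (simp add: tables_def card_PiE)

text \<open>Choose an entry \<open>(i, c)\<close> where the tables differ. Up to \<open>i\<close>
  the maps \<open>b\<close> are constantly \<open>c\<close>, which forgets the past; the next one
  sends \<open>a (i, c)\<close> to 0 and all else to 1, and the remaining ones preserve 0 and
  1.\<close>

lemma alternating_distinguishes:
  assumes a: "a \<in> tables r m" "a' \<in> tables r m"
    and "a \<noteq> a'" and "2 \<le> m"
  shows "\<exists>b. (\<forall>j x. b j x < m) \<and> alternating (table a) b r = 0 \<and> alternating (table a') b r = 1"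
proof -
  obtain i c where ic: "i < r" "2 \<le> c" "c < m" "a (i, c) \<noteq> a' (i, c)"
    using PiE_ext[OF a[unfolded tables_def]] \<open>a \<noteq> a'\<close> by fastforce
  define b where "b = (\<lambda>j x. if j \<le> i then c else
    if j = Suc i \<and> x = a (i, c) \<or> j > Suc i \<and> x = 0 then 0 else 1 :: nat)"
  have at: "alternating (table z) b i = c" for z
    by (cases i) (simp_all add: b_def)
  have "alternating (table a) b j = 0 \<and> alternating (table a') b j = 1" if "Suc i \<le> j" for j
    using that
  proof (induction j rule: dec_induct)
    case base
    show ?case using ic by (simp add: at) (simp add: b_def table_def)
  next
    case (step j)
    thus ?case by (simp add: b_def table_def)
  qed
  moreover have "\<forall>j x. b j x < m" using ic \<open>2 \<le> m\<close> by (simp add: b_def)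
  ultimately show ?thesis using ic(1) by (meson Suc_leI)
qed

lemma table_less:
  assumes "a \<in> tables r m" "i < r" "c < m"
  shows "table a i c < m"
  using assms PiE_mem[OF assms(1)[unfolded tables_def], of "(i, c)"] by (auto simp: table_def)

section \<open>The separating function\<close>

text \<open>There are twice as many blocks as addresses \<open>k * (2 * m)\<close>, because a
  balanced cut only guarantees \<open>k * m\<close> usable blocks in each half.\<close>

locale jump_function =
  fixes X :: "'x set" and xs :: "'x list" and k m L :: nat
  assumes finite_X: "finite X" and distinct_xs: "distinct xs" and xs_X: "set xs \<subseteq> X"
    and length_xs: "length xs = (4 * k * m) * (L + (4 * m - 1))"
    and L_pos: "0 < L" and code_bound: "k * (2 * m) < 2 ^ L" and m_pos: "2 \<le> m" and k_pos: "2 \<le> k"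
begin

text \<open>Block \<open>q\<close> consists of the \<open>len\<close> variables of \<open>xs\<close> from position \<open>q * len\<close> on: \<open>L\<close> address bits
  followed by \<open>valbits\<close> value bits. The address (round \<open>i\<close>, pointer \<open>c\<close>) is coded as \<open>i * M + c\<close>;
  the bound on \<open>k * (2 * m)\<close> leaves the code \<open>k * M\<close> for blocks that are never read.\<close>

definition M :: nat where "M = 2 * m"
definition blocks :: nat where "blocks = 4 * k * m"
definition valbits :: nat where "valbits = 2 * M - 1"
definition len :: nat where "len = L + valbits"

definition var :: "nat \<Rightarrow> nat \<Rightarrow> 'x" where
  "var q j = xs ! (q * len + j)"

text \<open>The truncation keeps the pointer below \<open>M\<close> although up to
  \<open>2 * M - 1\<close> value bits may be set.\<close>

definition block_map :: "nat \<Rightarrow> nat \<Rightarrow> ('x \<Rightarrow> bool) \<Rightarrow> nat \<Rightarrow> nat" where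
  "block_map i q \<nu> c = (if \<forall>j<L. \<nu> (var q j) = bit (i * M + c) j
     then min (M - 1) (card {j. j < valbits \<and> \<nu> (var q (L + j))}) else c)"

primrec pointer :: "('x \<Rightarrow> bool) \<Rightarrow> nat \<Rightarrow> nat" where
  "pointer \<nu> 0 = 0"
| "pointer \<nu> (Suc B) = block_map (B div blocks) (B mod blocks) \<nu> (pointer \<nu> B)"

definition jump :: "('x \<Rightarrow> bool) \<Rightarrow> bool" where
  "jump = (\<lambda>\<nu>\<in>inputs X. pointer \<nu> (k * blocks) = 0)"

lemma M_pos: "0 < M" using m_pos by (simp add: M_def)
lemma valbits_pos: "0 < valbits" using m_pos by (simp add: valbits_def M_def)
lemma len_pos: "0 < len" using L_pos by (simp add: len_def)

lemma length_xs': "length xs = blocks * len"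
  using length_xs by (simp add: blocks_def len_def valbits_def M_def)

lemma var_index: "q < blocks \<Longrightarrow> j < len \<Longrightarrow> q * len + j < length xs"
proof -
  assume "q < blocks" "j < len"
  hence "q * len + j < Suc q * len" by simp
  also have "\<dots> \<le> blocks * len" using \<open>q < blocks\<close> by (intro mult_le_mono1) simp
  finally show ?thesis by (simp add: length_xs')
qed

lemma var_X: "q < blocks \<Longrightarrow> j < len \<Longrightarrow> var q j \<in> X"
  using var_index xs_X by (auto simp: var_def)

lemma var_inject:
  assumes "q < blocks" "j < len" "q' < blocks" "j' < len"
  shows "var q j = var q' j' \<longleftrightarrow> q = q' \<and> j = j'"
proof
  assume "var q j = var q' j'"
  hence eq: "q * len + j = q' * len + j'"
    using distinct_xs var_index assms by (auto simp: var_def nth_eq_iff_index_eq)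
  have "q = (q * len + j) div len" "j = (q * len + j) mod len"
    "q' = (q' * len + j') div len" "j' = (q' * len + j') mod len"
    using assms by simp_all
  thus "q = q' \<and> j = j'" using eq by metis
qed auto

lemma pointer_less: "pointer \<nu> B < M"
  using M_pos by (induction B) (auto simp: block_map_def)

text \<open>State \<open>(\<kappa>, c)\<close>: \<open>c\<close> is the current pointer while \<open>\<kappa>\<close> records whether the address read so
  far matches it; once a whole address has matched, \<open>c\<close> counts the value bits.\<close>

definition transition :: "nat \<Rightarrow> bool \<times> nat \<Rightarrow> bool \<Rightarrow> bool \<times> nat" where
  "transition t s b = (let i = t div (len * blocks); j = t mod len; \<kappa> = fst s; c = snd s in
     if j < L then ((j = 0 \<or> \<kappa>) \<and> b = bit (i * M + c) j, c)
     else (\<kappa>, if \<kappa> then min (M - 1) ((if j = L then 0 else c) + of_bool b) else c))"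

text \<open>At a block boundary the flag is left over from the previous block. Only the second
  component counts, since the first address bit overwrites the flag.\<close>

lemma automaton_pointer: "snd (automaton_state transition xs (False, 0) \<nu> (B * len)) = pointer \<nu> B"
proof (induction B)
  case 0 show ?case by simp
next
  case (Suc B)
  let ?st = "automaton_state transition xs (False, 0) \<nu>"
  let ?i = "B div blocks" and ?q = "B mod blocks" and ?c = "pointer \<nu> B"
  let ?match = "\<lambda>j. \<forall>j'<j. \<nu> (var ?q j') = bit (?i * M + ?c) j'"
  let ?cnt = "\<lambda>r. card {j. j < r \<and> \<nu> (var ?q (L + j))}"
  have idx: "(B * len + j) div (len * blocks) = ?i" "(B * len + j) mod len = j"
    "xs ! ((B * len + j) mod length xs) = var ?q j" if "j < len" for j
  proof -
    show "(B * len + j) div (len * blocks) = ?i" "(B * len + j) mod len = j"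
      using that by (simp_all add: div_mult2_eq)
    have "(B * len + j) mod (len * blocks) = ?q * len + j"
      using that by (simp add: mod_mult2_eq)
    thus "xs ! ((B * len + j) mod length xs) = var ?q j"
      by (simp add: length_xs' var_def mult.commute)
  qed
  have step: "?st (B * len + Suc j) = transition (B * len + j) (?st (B * len + j)) (\<nu> (var ?q j))"
    if "j < len" for j
    using idx[OF that] by simp
  have addr: "?st (B * len + Suc j) = (?match (Suc j), ?c)" if "j < L" for j
    using that
  proof (induction j)
    case 0
    have "transition (B * len) s b = (b = bit (?i * M + snd s) 0, snd s)" for s b
      using idx(1,2)[OF len_pos] L_pos by (simp add: transition_def Let_def)
    thus ?case using step[OF len_pos] Suc.IH by simp
  next
    case (Suc j)
    hence "Suc j < len" "Suc j < L" by (simp_all add: len_def)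
    have "transition (B * len + Suc j) (p, ?c) b = (p \<and> b = bit (?i * M + ?c) (Suc j), ?c)" for p b
      using idx(1,2)[OF \<open>Suc j < len\<close>] Suc.prems by (simp add: transition_def Let_def)
    moreover have "?match (Suc (Suc j)) \<longleftrightarrow>
      ?match (Suc j) \<and> \<nu> (var ?q (Suc j)) = bit (?i * M + ?c) (Suc j)"
      unfolding less_Suc_eq[of _ "Suc j"] by blast
    ultimately show ?case
      using step[OF \<open>Suc j < len\<close>] Suc.IH Suc.prems by (simp only: Suc_lessD)
  qed
  \<comment> \<open>For \<open>r = 0\<close> the slot still holds the old pointer, which the address
    test needed; the counter takes it over at the first value bit.\<close>
  have val: "?st (B * len + (L + r)) = (?match L, if ?match L \<and> 0 < r then min (M - 1) (?cnt r) else ?c)"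
    if "r \<le> valbits" for r
    using that
  proof (induction r)
    case 0
    obtain L' where "L = Suc L'" using L_pos gr0_conv_Suc by blast
    thus ?case using addr[of L'] by simp
  next
    case (Suc r)
    hence lt: "L + r < len" by (simp add: len_def)
    have "{j. j < Suc r \<and> \<nu> (var ?q (L + j))} =
      (if \<nu> (var ?q (L + r)) then insert r {j. j < r \<and> \<nu> (var ?q (L + j))}
       else {j. j < r \<and> \<nu> (var ?q (L + j))})"
      by (auto simp: less_Suc_eq)
    hence cnt: "?cnt (Suc r) = ?cnt r + of_bool (\<nu> (var ?q (L + r)))" by simp
    have st: "?st (B * len + (L + Suc r)) =
      transition (B * len + (L + r)) (?match L, if ?match L \<and> 0 < r then min (M - 1) (?cnt r) else ?c)
        (\<nu> (var ?q (L + r)))"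
      using step[OF lt] Suc by simp
    \<comment> \<open>A saturating counter: truncating after every bit equals truncating the total.
      The count 0 at \<open>r = 0\<close> corresponds to the reset at \<open>j = L\<close>.\<close>
    have "transition (B * len + (L + r)) (p, if p \<and> 0 < r then min (M - 1) a else ?c) b =
      (p, if p then min (M - 1) (a + of_bool b) else ?c)" if "r = 0 \<longrightarrow> a = 0" for p a b
      unfolding transition_def Let_def idx(2)[OF lt] fst_conv snd_conv using that
      by (cases p; cases "r = 0") simp_all
    note tr = this[of "?cnt r" "?match L"]
    have "r = 0 \<longrightarrow> ?cnt r = 0" by simp
    from tr[OF this] show ?case unfolding st cnt by (simp only: zero_less_Suc simp_thms)
  qed
  have "Suc B * len = B * len + (L + valbits)" by (simp add: len_def)
  thus ?case using val[of valbits] valbits_pos by (simp only:) (simp add: block_map_def)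
qed

lemma jump_k_OBDD:
  assumes "4 * m \<le> w"
  shows "jump \<in> k_OBDD X k w"
proof (rule k_OBDD_automaton)
  let ?S = "UNIV \<times> {..<M} :: (bool \<times> nat) set"
  show "finite ?S" by simp
  show "card ?S \<le> w" using assms by (simp add: card_cartesian_product M_def)
  show "(False, 0) \<in> ?S" using M_pos by simp
  show "transition t s b \<in> ?S" if "s \<in> ?S" for t s b
  proof (cases s)
    case (Pair \<kappa> c)
    thus ?thesis using that M_pos by (simp add: transition_def Let_def min.strict_coboundedI1)
  qed
  show "distinct xs" "set xs \<subseteq> X" by (fact distinct_xs xs_X)+
  show "jump \<in> boolean_functions X" by (simp add: jump_def)
  show "jump \<nu> = (snd (automaton_state transition xs (False, 0) \<nu> (k * length xs)) = 0)"
    if "\<nu> \<in> inputs X" for \<nu>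
    using that automaton_pointer[of \<nu> "k * blocks"]
    by (simp add: jump_def length_xs' mult.assoc)
qed

end

section \<open>Tables hidden behind a cut\<close>

context jump_function
begin

lemma code_less: "i < k \<Longrightarrow> c < M \<Longrightarrow> i * M + c < k * M"
proof -
  assume "i < k" "c < M"
  hence "i * M + c < Suc i * M" by simp
  also have "\<dots> \<le> k * M" using \<open>i < k\<close> by (intro mult_le_mono1) simp
  finally show ?thesis .
qed

lemma block_map_addr:
  assumes "\<forall>j<L. \<nu> (var q j) = bit a j" "a < 2 ^ L" "i < k" "c < M"
    and "card {j. j < valbits \<and> \<nu> (var q (L + j))} < M"
  shows "block_map i q \<nu> c =
    (if a = i * M + c then card {j. j < valbits \<and> \<nu> (var q (L + j))} else c)"
proof -
  have "i * M + c < 2 ^ L" using code_less[OF assms(3,4)] code_bound by (simp add: M_def)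
  from nat_eq_iff_low_bits[OF assms(2) this] show ?thesis
    using assms(1,5) by (simp add: block_map_def)
qed

text \<open>This is \<open>two_jumps\<close> inside round \<open>i\<close>, the offset
  \<open>i * M\<close> singling out the addresses of that round.\<close>

lemma pointer_layer:
  assumes \<nu>: "\<And>q j. q < blocks \<Longrightarrow> j < L \<Longrightarrow> \<nu> (var q j) = bit (ad q) j"
      "\<And>q. q < blocks \<Longrightarrow> ad q < 2 ^ L" "\<And>q. q < blocks \<Longrightarrow> vl q < M"
      "\<And>q. q < blocks \<Longrightarrow> card {j. j < valbits \<and> \<nu> (var q (L + j))} = vl q"
    and i: "i < k" and start: "pointer \<nu> (i * blocks) = c"
    and q1: "q1 < h" "ad q1 = i * M + c" "vl q1 = c'"
      "\<And>q. q < blocks \<Longrightarrow> ad q = i * M + c \<Longrightarrow> q = q1"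
    and q2: "h \<le> q2" "q2 < blocks" "ad q2 = i * M + c'" "vl q2 = c''"
      "\<And>q. q < blocks \<Longrightarrow> ad q = i * M + c' \<Longrightarrow> q = q2"
    and low: "\<And>q. q < blocks \<Longrightarrow> ad q = i * M + c'' \<Longrightarrow> q < h"
  shows "pointer \<nu> (Suc i * blocks) = c''"
proof -
  have "pointer \<nu> (i * blocks + blocks) = c''"
  proof (rule two_jumps[where s = "\<lambda>q. pointer \<nu> (i * blocks + q)" and n = "i * M" and Q = blocks])
    fix q assume q: "q < blocks"
    have "block_map i q \<nu> (pointer \<nu> (i * blocks + q)) =
      (if ad q = i * M + pointer \<nu> (i * blocks + q) then vl q else pointer \<nu> (i * blocks + q))"
      using block_map_addr[of \<nu> q "ad q" i] \<nu> q i pointer_less by simp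
    thus "pointer \<nu> (i * blocks + Suc q) =
      (if ad q = i * M + pointer \<nu> (i * blocks + q) then vl q else pointer \<nu> (i * blocks + q))"
      using q by simp
  next
    show "pointer \<nu> (i * blocks + 0) = c" using start by simp
  qed (fact q1 q2 low)+
  thus ?thesis by (simp add: add.commute)
qed

text \<open>A value has \<open>2 * M - 1\<close> bits, so a block that is not rich in \<open>A\<close> has at least \<open>M\<close> value bits
  outside \<open>A\<close>.\<close>

definition rich :: "'x set \<Rightarrow> nat set" where
  "rich A = {q. q < blocks \<and> M \<le> card {j. j < valbits \<and> var q (L + j) \<in> A}}"

lemma rich_subset: "rich A \<subseteq> {..<blocks}" by (auto simp: rich_def)

lemma rich_mono: "A \<subseteq> B \<Longrightarrow> rich A \<subseteq> rich B"
proof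
  fix q assume AB: "A \<subseteq> B" and q: "q \<in> rich A"
  have "card {j. j < valbits \<and> var q (L + j) \<in> A} \<le> card {j. j < valbits \<and> var q (L + j) \<in> B}"
    using AB by (intro card_mono) auto
  thus "q \<in> rich B" using q by (simp add: rich_def)
qed

text \<open>A variable lies in at most one block, so adding it can make at most one block
  rich.\<close>

lemma card_rich_insert: "card (rich (insert x A)) \<le> Suc (card (rich A))"
proof -
  have *: "q = q'" if q: "q \<in> rich (insert x A) - rich A" "q' \<in> rich (insert x A) - rich A" for q q'
  proof -
    have "\<exists>j<valbits. x = var q (L + j)" if q: "q \<in> rich (insert x A) - rich A" for q
    proof (rule ccontr)
      assume "\<not> ?thesis"
      hence "{j. j < valbits \<and> var q (L + j) \<in> insert x A} = {j. j < valbits \<and> var q (L + j) \<in> A}"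
        by auto
      thus False using q by (auto simp: rich_def)
    qed
    from this[OF q(1)] this[OF q(2)] obtain j j' where j: "j < valbits" "x = var q (L + j)"
      "j' < valbits" "x = var q' (L + j')" by blast
    moreover have "q < blocks" "q' < blocks" using q rich_subset by auto
    ultimately show "q = q'" using var_inject[of q "L + j" q' "L + j'"] by (simp add: len_def)
  qed
  have fin: "finite (rich B)" for B using finite_subset[OF rich_subset] by simp
  have "card (rich (insert x A) - rich A) \<le> Suc 0"
    unfolding card_le_Suc0_iff_eq[OF finite_Diff[OF fin]] using * by blast
  moreover have "card (rich (insert x A)) = card (rich (insert x A) - rich A) + card (rich A)"
    using card_Diff_subset[OF fin rich_mono, of A "insert x A"] card_mono[OF fin rich_mono, of A "insert x A"]
    by (simp add: subset_insertI)
  ultimately show ?thesis by simp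
qed

lemma rich_empty: "rich {} = {}" using M_pos by (auto simp: rich_def)

lemma rich_all: "X \<subseteq> A \<Longrightarrow> rich A = {..<blocks}"
proof -
  assume "X \<subseteq> A"
  hence "{j. j < valbits \<and> var q (L + j) \<in> A} = {..<valbits}" if "q < blocks" for q
    using var_X[OF that] by (auto simp: len_def)
  moreover have "M \<le> valbits" using M_pos by (simp add: valbits_def)
  ultimately show ?thesis by (auto simp: rich_def)
qed

text \<open>A discrete intermediate value argument: the number of rich blocks climbs from 0 to
  \<open>4 * k * m\<close> in steps of at most 1.\<close>

lemma balanced_cut:
  assumes "X \<subseteq> set ys"
  shows "\<exists>u<length ys. card (rich (set (take u ys))) = 2 * k * m"
proof -
  let ?f = "\<lambda>u. int (card (rich (set (take u ys))))"
  have "\<exists>u\<le>length ys. ?f u = int (2 * k * m)"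
  proof (rule nat0_intermed_int_val)
    show "\<forall>i<length ys. \<bar>?f (i + 1) - ?f i\<bar> \<le> 1"
    proof (intro allI impI)
      fix i assume "i < length ys"
      hence "set (take (i + 1) ys) = insert (ys ! i) (set (take i ys))"
        by (simp add: take_Suc_conv_app_nth)
      moreover have "card (rich (set (take i ys))) \<le> card (rich (insert (ys ! i) (set (take i ys))))"
        by (intro card_mono rich_mono) (auto intro: finite_subset[OF rich_subset])
      ultimately show "\<bar>?f (i + 1) - ?f i\<bar> \<le> 1"
        using card_rich_insert[of "ys ! i" "set (take i ys)"] by simp
    qed
    show "?f 0 \<le> int (2 * k * m)" by (simp add: rich_empty)
    show "int (2 * k * m) \<le> ?f (length ys)" using rich_all[OF assms] by (simp add: blocks_def)
  qed
  then obtain u where u: "u \<le> length ys" "card (rich (set (take u ys))) = 2 * k * m"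
    by (metis of_nat_eq_iff)
  moreover have "u \<noteq> length ys"
  proof
    assume "u = length ys"
    hence "4 * k * m = 2 * k * m" using u(2) rich_all[OF assms] by (simp add: blocks_def)
    thus False using m_pos k_pos by simp
  qed
  ultimately show ?thesis using le_neq_implies_less by blast
qed

end

section \<open>Inputs that realise prescribed jump maps\<close>

locale jump_cut = jump_function +
  fixes A :: "'a set" and \<alpha> \<beta> :: "nat \<times> nat \<Rightarrow> nat"
  assumes inj_\<alpha>: "inj_on \<alpha> ({..<k} \<times> {..<m})" and inj_\<beta>: "inj_on \<beta> ({..<k} \<times> {..<m})"
    and \<alpha>_low: "\<alpha> ` ({..<k} \<times> {..<m}) \<subseteq> {..<2 * k * m}"
    and \<beta>_high: "\<beta> ` ({..<k} \<times> {..<m}) \<subseteq> {2 * k * m..<4 * k * m}"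
begin

abbreviation I :: "(nat \<times> nat) set" where "I \<equiv> {..<k} \<times> {..<m}"

text \<open>Pointers below \<open>m\<close> are looked up in the first half, through
  \<open>\<alpha>\<close>, and the others in the second half, through \<open>\<beta>\<close>. With
  \<open>contents\<close>, a round sends \<open>c\<close> to \<open>m + g i c\<close> and then back
  below \<open>m\<close> to \<open>h i (g i c)\<close>.\<close>

definition address :: "nat \<Rightarrow> nat" where
  "address q = (if q \<in> \<alpha> ` I then (case inv_into I \<alpha> q of (i, c) \<Rightarrow> i * M + c)
     else if q \<in> \<beta> ` I then (case inv_into I \<beta> q of (i, c) \<Rightarrow> i * M + (m + c)) else k * M)"

definition contents :: "(nat \<Rightarrow> nat \<Rightarrow> nat) \<Rightarrow> (nat \<Rightarrow> nat \<Rightarrow> nat) \<Rightarrow> nat \<Rightarrow> nat" where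
  "contents g h q = (if q \<in> \<alpha> ` I then (case inv_into I \<alpha> q of (i, c) \<Rightarrow> m + g i c)
     else if q \<in> \<beta> ` I then (case inv_into I \<beta> q of (i, c) \<Rightarrow> h i c) else 0)"

lemma \<alpha>: "i < k \<Longrightarrow> c < m \<Longrightarrow> \<alpha> (i, c) < 2 * k * m"
  and \<beta>: "i < k \<Longrightarrow> c < m \<Longrightarrow> 2 * k * m \<le> \<beta> (i, c) \<and> \<beta> (i, c) < blocks"
  using \<alpha>_low \<beta>_high by (auto simp: blocks_def image_subset_iff)

lemma \<alpha>_data: "i < k \<Longrightarrow> c < m \<Longrightarrow> address (\<alpha> (i, c)) = i * M + c \<and> contents g h (\<alpha> (i, c)) = m + g i c"
  by (simp add: address_def contents_def inv_into_f_f[OF inj_\<alpha>])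

lemma \<beta>_data:
  assumes "i < k" "c < m"
  shows "address (\<beta> (i, c)) = i * M + (m + c) \<and> contents g h (\<beta> (i, c)) = h i c"
proof -
  have "\<beta> (i, c) \<notin> \<alpha> ` I" using \<alpha> \<beta>[OF assms] by force
  thus ?thesis using assms by (simp add: address_def contents_def inv_into_f_f[OF inj_\<beta>])
qed

lemma block_cases:
  obtains (low) i c where "i < k" "c < m" "q = \<alpha> (i, c)"
  | (high) i c where "i < k" "c < m" "q = \<beta> (i, c)"
  | (unused) "q \<notin> \<alpha> ` I" "q \<notin> \<beta> ` I" "address q = k * M" "\<And>g h. contents g h q = 0"
  by (cases "q \<in> \<alpha> ` I"; cases "q \<in> \<beta> ` I") (auto simp: address_def contents_def)

lemma address_bound: "address q < 2 ^ L"
proof -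
  have "address q \<le> k * M"
  proof (cases q rule: block_cases)
    case (low i c)
    thus ?thesis using \<alpha>_data[of i c] code_less[of i c] by (simp add: M_def)
  next
    case (high i c)
    thus ?thesis using \<beta>_data[of i c] code_less[of i "m + c"] by (simp add: M_def)
  qed simp
  thus ?thesis using code_bound by (simp add: M_def)
qed

lemma address_low: "address q = i * M + c \<longleftrightarrow> q = \<alpha> (i, c)" if "i < k" "c < m"
proof
  assume eq: "address q = i * M + c"
  have c: "c < M" using that by (simp add: M_def)
  show "q = \<alpha> (i, c)"
  proof (cases q rule: block_cases)
    case (low i' c')
    hence "i' * M + c' = i * M + c" "c' < M" using eq \<alpha>_data[of i' c'] by (simp_all add: M_def)
    thus ?thesis using low(3) mult_add_eq_iff[OF _ c] by simp
  next
    case (high i' c')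
    hence "i' * M + (m + c') = i * M + c" "m + c' < M" using eq \<beta>_data[of i' c'] by (simp_all add: M_def)
    thus ?thesis using mult_add_eq_iff[OF _ c] that(2) by simp
  next
    case unused
    thus ?thesis using eq code_less[OF that(1) c] by simp
  qed
qed (use \<alpha>_data[OF that] in simp)

lemma address_high: "address q = i * M + (m + c) \<longleftrightarrow> q = \<beta> (i, c)" if "i < k" "c < m"
proof
  assume eq: "address q = i * M + (m + c)"
  have c: "m + c < M" using that by (simp add: M_def)
  show "q = \<beta> (i, c)"
  proof (cases q rule: block_cases)
    case (low i' c')
    hence "i' * M + c' = i * M + (m + c)" "c' < M" using eq \<alpha>_data[of i' c'] by (simp_all add: M_def)
    thus ?thesis using mult_add_eq_iff[OF _ c] low(2) by simp
  next
    case (high i' c')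
    hence "i' * M + (m + c') = i * M + (m + c)" "m + c' < M"
      using eq \<beta>_data[of i' c'] by (simp_all add: M_def)
    thus ?thesis using high(3) mult_add_eq_iff[OF _ c] by simp
  next
    case unused
    thus ?thesis using eq code_less[OF that(1) c] by simp
  qed
qed (use \<beta>_data[OF that] in simp)

text \<open>The value bits of a block that lie on its own side of the cut; all others are kept \<open>False\<close>.\<close>

definition own :: "nat \<Rightarrow> nat set" where
  "own q = {j. j < valbits \<and> (var q (L + j) \<in> A \<longleftrightarrow> q \<in> rich A)}"

lemma card_own: "q < blocks \<Longrightarrow> M \<le> card (own q)"
proof (cases "q \<in> rich A")
  case True
  thus ?thesis by (simp add: own_def) (simp add: rich_def)
next
  case False
  assume "q < blocks"
  let ?P = "{j. j < valbits \<and> var q (L + j) \<in> A}"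
  have "own q = {..<valbits} - ?P" using False by (auto simp: own_def)
  hence "card (own q) = valbits - card ?P" by (simp add: card_Diff_subset subset_iff)
  moreover have "card ?P < M" using False \<open>q < blocks\<close> by (simp add: rich_def)
  ultimately show ?thesis by (simp add: valbits_def)
qed

text \<open>The choice depends on \<open>q\<close> and \<open>y\<close> alone, so equal values of a
  block are written with the same bits.\<close>

definition ones :: "nat \<Rightarrow> nat \<Rightarrow> nat set" where
  "ones q y = (SOME Z. Z \<subseteq> own q \<and> card Z = y)"

lemma ones: "q < blocks \<Longrightarrow> y < M \<Longrightarrow> ones q y \<subseteq> own q \<and> card (ones q y) = y"
  unfolding ones_def by (rule someI_ex) (meson card_own less_imp_le_nat obtain_subset_with_card_n order_trans)

text \<open>The addresses do not depend on \<open>v\<close>; only value bits carry information about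
  the tables.\<close>

definition input :: "(nat \<Rightarrow> nat) \<Rightarrow> 'a \<Rightarrow> bool" where
  "input v = (\<lambda>x\<in>X. \<exists>q<blocks. (\<exists>j<L. x = var q j \<and> bit (address q) j) \<or>
     (\<exists>j\<in>ones q (v q). x = var q (L + j)))"

lemma input_inputs: "input v \<in> inputs X" by (simp add: input_def)

lemma ones_valbits: "q < blocks \<Longrightarrow> y < M \<Longrightarrow> j \<in> ones q y \<Longrightarrow> L + j < len"
  using ones[of q y] by (auto simp: own_def len_def)

lemma input_address:
  assumes "\<And>q. v q < M" "q < blocks" "j < L"
  shows "input v (var q j) = bit (address q) j"
proof -
  have j: "j < len" using assms by (simp add: len_def)
  have "\<not> (\<exists>j'\<in>ones q' (v q'). var q j = var q' (L + j'))" if "q' < blocks" for q'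
    using ones_valbits[OF that assms(1)] var_inject[OF assms(2) j that] assms(3) by fastforce
  moreover have "(\<exists>j'<L. var q j = var q' j' \<and> bit (address q') j') \<longleftrightarrow> q' = q \<and> bit (address q) j"
    if "q' < blocks" for q'
  proof -
    have "var q j = var q' j' \<longleftrightarrow> q = q' \<and> j = j'" if "j' < L" for j'
      using var_inject[OF assms(2) j \<open>q' < blocks\<close>, of j'] that by (simp add: len_def)
    thus ?thesis using assms(3) by metis
  qed
  ultimately show ?thesis
    unfolding input_def using var_X[OF assms(2) j] assms(2) by auto
qed

lemma input_value:
  assumes "\<And>q. v q < M" "q < blocks"
  shows "{j. j < valbits \<and> input v (var q (L + j))} = ones q (v q)"
proof -
  have "input v (var q (L + j)) \<longleftrightarrow> j \<in> ones q (v q)" if "j < valbits" for j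
  proof -
    have j: "L + j < len" using that by (simp add: len_def)
    have "(\<exists>j'\<in>ones q' (v q'). var q (L + j) = var q' (L + j')) \<longleftrightarrow> q' = q \<and> j \<in> ones q (v q)"
      if "q' < blocks" for q'
      using ones_valbits[OF that assms(1)] var_inject[OF assms(2) j that] by auto
    moreover have "\<not> (\<exists>j'<L. var q (L + j) = var q' j' \<and> bit (address q') j')" if "q' < blocks" for q'
    proof -
      have "var q (L + j) \<noteq> var q' j'" if "j' < L" for j'
        using var_inject[OF assms(2) j \<open>q' < blocks\<close>, of j'] that by (simp add: len_def)
      thus ?thesis by metis
    qed
    ultimately show ?thesis
      unfolding input_def using var_X[OF assms(2) j] assms(2) by auto
  qed
  moreover have "ones q (v q) \<subseteq> {..<valbits}" using ones[OF assms(2,1)] by (auto simp: own_def)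
  ultimately show ?thesis by auto
qed

text \<open>A value bit is set only on the side of its block, so blocks owned by the other side
  cannot influence the value at \<open>x\<close>.\<close>

lemma input_cong:
  assumes "\<And>q. v q < M" "\<And>q. v' q < M"
    and "\<And>q. q < blocks \<Longrightarrow> (q \<in> rich A \<longleftrightarrow> x \<in> A) \<Longrightarrow> v q = v' q"
  shows "input v x = input v' x"
proof -
  have imp: "\<exists>j\<in>ones q (v' q). x = var q (L + j)"
    if v: "\<And>q. v q < M" "\<And>q. q < blocks \<Longrightarrow> (q \<in> rich A \<longleftrightarrow> x \<in> A) \<Longrightarrow> v q = v' q"
      and q: "q < blocks" "\<exists>j\<in>ones q (v q). x = var q (L + j)" for q v v'
  proof -
    obtain j where j: "j \<in> ones q (v q)" "x = var q (L + j)" using q(2) by blast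
    hence "j \<in> own q" using ones[OF q(1) v(1)] by blast
    hence "q \<in> rich A \<longleftrightarrow> x \<in> A" using j by (auto simp: own_def)
    hence "v q = v' q" using v(2) q(1) by blast
    thus ?thesis using j by auto
  qed
  have "(\<exists>j\<in>ones q (v q). x = var q (L + j)) \<longleftrightarrow> (\<exists>j\<in>ones q (v' q). x = var q (L + j))"
    if "q < blocks" for q
  proof
    show "\<exists>j\<in>ones q (v' q). x = var q (L + j)" if "\<exists>j\<in>ones q (v q). x = var q (L + j)"
      by (rule imp[where v = v and v' = v', OF assms(1) assms(3) \<open>q < blocks\<close> that])
    show "\<exists>j\<in>ones q (v q). x = var q (L + j)" if "\<exists>j\<in>ones q (v' q). x = var q (L + j)"
      by (rule imp[where v = v' and v' = v, OF assms(2) assms(3)[symmetric] \<open>q < blocks\<close> that])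
  qed
  hence "(\<exists>q<blocks. P q \<or> (\<exists>j\<in>ones q (v q). x = var q (L + j))) \<longleftrightarrow>
    (\<exists>q<blocks. P q \<or> (\<exists>j\<in>ones q (v' q). x = var q (L + j)))" for P by blast
  thus ?thesis by (simp add: input_def)
qed

abbreviation bounded :: "(nat \<Rightarrow> nat \<Rightarrow> nat) \<Rightarrow> bool" where
  "bounded g \<equiv> \<forall>i<k. \<forall>c<m. g i c < m"

lemma contents_less: "bounded g \<Longrightarrow> bounded h \<Longrightarrow> contents g h q < M"
proof (cases q rule: block_cases)
  case (low i c)
  assume "bounded g" "bounded h"
  thus ?thesis using low \<alpha>_data[of i c] by (simp add: M_def)
next
  case (high i c)
  assume "bounded g" "bounded h"
  hence "h i c < m" using high by simp
  thus ?thesis using high \<beta>_data[of i c] by (simp add: M_def)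
qed (use M_pos in simp)

lemma pointer_input:
  assumes g: "bounded g" and h: "bounded h" and "i \<le> k"
  shows "pointer (input (contents g h)) (i * blocks) = iterate g h i \<and> iterate g h i < m"
  using \<open>i \<le> k\<close>
proof (induction i)
  case 0
  show ?case using m_pos by simp
next
  case (Suc i)
  let ?\<nu> = "input (contents g h)" and ?c = "iterate g h i"
  note less = contents_less[OF g h]
  have i: "i < k" and c: "pointer ?\<nu> (i * blocks) = ?c" "?c < m" using Suc by auto
  have gc: "g i ?c < m" and hc: "h i (g i ?c) < m" using g h i c by auto
  have "pointer ?\<nu> (Suc i * blocks) = h i (g i ?c)"
  proof (rule pointer_layer[where ad = address and vl = "contents g h" and h = "2 * k * m"
        and ?q1.0 = "\<alpha> (i, ?c)" and ?q2.0 = "\<beta> (i, g i ?c)" and c = ?c and c' = "m + g i ?c"])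
    show "card {j. j < valbits \<and> ?\<nu> (var q (L + j))} = contents g h q" if "q < blocks" for q
      using input_value[OF less that] ones[OF that less] by simp
    \<comment> \<open>The pointer is below \<open>m\<close> again, so its block lies in the first
      half and cannot trigger a third jump in this round.\<close>
    show "q < 2 * k * m" if "address q = i * M + h i (g i ?c)" for q
      using that address_low[OF i hc] \<alpha>[OF i hc] by simp
    show "contents g h (\<alpha> (i, ?c)) = m + g i ?c" "address (\<alpha> (i, ?c)) = i * M + ?c"
      using \<alpha>_data[OF i c(2)] by simp_all
    show "contents g h (\<beta> (i, g i ?c)) = h i (g i ?c)"
      "address (\<beta> (i, g i ?c)) = i * M + (m + g i ?c)"
      using \<beta>_data[OF i gc] by simp_all
    show "q = \<alpha> (i, ?c)" if "address q = i * M + ?c" for q using that address_low[OF i c(2)] by simp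
    show "q = \<beta> (i, g i ?c)" if "address q = i * M + (m + g i ?c)" for q
      using that address_high[OF i gc] by simp
    show "\<alpha> (i, ?c) < 2 * k * m" by (rule \<alpha>[OF i c(2)])
    show "2 * k * m \<le> \<beta> (i, g i ?c)" "\<beta> (i, g i ?c) < blocks" using \<beta>[OF i gc] by simp_all
    show "?\<nu> (var q j) = bit (address q) j" if "q < blocks" "j < L" for q j
      by (rule input_address[OF less that])
  qed (rule i c(1) less address_bound)+
  thus ?case using hc by simp
qed

lemma jump_input:
  assumes "bounded g" "bounded h"
  shows "jump (input (contents g h)) \<longleftrightarrow> iterate g h k = 0"
  using pointer_input[OF assms, of k] input_inputs by (simp add: jump_def)

lemma contents_cong:
  assumes "\<And>i c. i < k \<Longrightarrow> c < m \<Longrightarrow> \<alpha> (i, c) \<in> Q \<Longrightarrow> g i c = g' i c"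
    and "\<And>i c. i < k \<Longrightarrow> c < m \<Longrightarrow> \<beta> (i, c) \<in> Q \<Longrightarrow> h i c = h' i c" and "q \<in> Q"
  shows "contents g h q = contents g' h' q"
  by (cases q rule: block_cases) (use assms \<alpha>_data \<beta>_data in auto)

end

section \<open>Fooling families for the two kinds of cut\<close>

context jump_cut
begin

lemma input_tables_cong:
  assumes "bounded g" "bounded h" "bounded g'" "bounded h'"
    and "\<And>i c. i < k \<Longrightarrow> c < m \<Longrightarrow> (\<alpha> (i, c) \<in> rich A \<longleftrightarrow> x \<in> A) \<Longrightarrow> g i c = g' i c"
    and "\<And>i c. i < k \<Longrightarrow> c < m \<Longrightarrow> (\<beta> (i, c) \<in> rich A \<longleftrightarrow> x \<in> A) \<Longrightarrow> h i c = h' i c"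
  shows "input (contents g h) x = input (contents g' h') x"
proof (rule input_cong)
  fix q assume "q \<in> rich A \<longleftrightarrow> x \<in> A"
  thus "contents g h q = contents g' h' q"
    using assms(5,6) by (intro contents_cong[of "{q. q \<in> rich A \<longleftrightarrow> x \<in> A}"]) auto
qed (use contents_less assms in auto)

text \<open>Here \<open>A\<close> owns the first jump of every round, and the complement supplies
  \<open>b\<close> as the second one.\<close>

lemma fooling_low:
  assumes "\<alpha> ` I \<subseteq> rich A" "\<beta> ` I \<inter> rich A = {}"
  shows "\<exists>enc. fooling_family X jump A (tables (k - 1) m) enc"
proof -
  have \<alpha>_rich: "\<alpha> (i, c) \<in> rich A" and \<beta>_poor: "\<beta> (i, c) \<notin> rich A" if "i < k" "c < m" for i c
    using assms that by auto
  \<comment> \<open>The alternation must begin with \<open>b\<close>, so the first jump of round 0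
    is constant and the tables act from round 1 on.\<close>
  define G where "G = (\<lambda>a i c. if i = 0 then 0 else table a (i - 1) c)"
  have G: "bounded (G a)" if "a \<in> tables (k - 1) m" for a
    using table_less[OF that] m_pos by (auto simp: G_def)
  have it: "iterate (G a) b (Suc i) = alternating (table a) b i" for a b i
    by (induction i) (simp_all add: G_def)
  have zero: "bounded (\<lambda>_ _. 0)" using m_pos by simp
  \<comment> \<open>The zero maps are placeholders: value bits of the \<open>\<beta>\<close> blocks
    are only set outside \<open>A\<close>.\<close>
  have "fooling_family X jump A (tables (k - 1) m) (\<lambda>a. input (contents (G a) (\<lambda>_ _. 0)))"
    unfolding fooling_family_def
  proof (intro ballI impI)
    fix a a' assume a: "a \<in> tables (k - 1) m" "a' \<in> tables (k - 1) m" "a \<noteq> a'"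
    obtain b where b: "\<forall>j x. b j x < m" "alternating (table a) b (k - 1) = 0"
      "alternating (table a') b (k - 1) = 1"
      using alternating_distinguishes[OF a m_pos] by blast
    have k_eq: "Suc (k - 1) = k" using k_pos by simp
    have bb: "bounded b" using b(1) by simp
    have neq: "jump (input (contents (G a) b)) \<noteq> jump (input (contents (G a') b))"
      using jump_input[OF G[OF a(1)] bb] jump_input[OF G[OF a(2)] bb]
        it[of a b "k - 1"] it[of a' b "k - 1"] b k_eq by simp
    have in_A: "input (contents (G z) b) x = input (contents (G z) (\<lambda>_ _. 0)) x"
      if "z \<in> tables (k - 1) m" "x \<in> A" for z x
      by (rule input_tables_cong[OF G[OF that(1)] bb G[OF that(1)] zero])
        (simp_all add: \<beta>_poor that(2))
    have off_A: "input (contents (G a) b) x = input (contents (G a') b) x" if "x \<notin> A" for x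
      by (rule input_tables_cong[OF G[OF a(1)] bb G[OF a(2)] bb]) (simp_all add: \<alpha>_rich that)
    show "\<exists>\<nu>\<in>inputs X. \<exists>\<nu>'\<in>inputs X. (\<forall>x\<in>A. \<nu> x = input (contents (G a) (\<lambda>_ _. 0)) x) \<and>
      (\<forall>x\<in>A. \<nu>' x = input (contents (G a') (\<lambda>_ _. 0)) x) \<and>
      (\<forall>x. x \<notin> A \<longrightarrow> \<nu> x = \<nu>' x) \<and> jump \<nu> \<noteq> jump \<nu>'"
      by (rule bexI[of _ "input (contents (G a) b)"], rule bexI[of _ "input (contents (G a') b)"])
        (intro conjI ballI allI impI in_A off_A neq a(1,2) input_inputs; assumption)+
  qed
  thus ?thesis by blast
qed

text \<open>The mirror image of \<open>fooling_low\<close>: \<open>A\<close> owns the second jump of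
  every round, and \<open>b\<close> is the first.\<close>

lemma fooling_high:
  assumes "\<beta> ` I \<subseteq> rich A" "\<alpha> ` I \<inter> rich A = {}"
  shows "\<exists>enc. fooling_family X jump A (tables (k - 1) m) enc"
proof -
  have \<beta>_rich: "\<beta> (i, c) \<in> rich A" and \<alpha>_poor: "\<alpha> (i, c) \<notin> rich A" if "i < k" "c < m" for i c
    using assms that by auto
  \<comment> \<open>The alternation must end with \<open>b\<close>, so the second jump of the last
    round is the identity.\<close>
  define H where "H = (\<lambda>a i c. if i < k - 1 then table a i c else c)"
  have H: "bounded (H a)" if "a \<in> tables (k - 1) m" for a
    using table_less[OF that] by (auto simp: H_def)
  have it: "b i (iterate b (H a) i) = alternating (table a) b i" if "i \<le> k - 1" for a b i
    using that by (induction i) (simp_all add: H_def)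
  have zero: "bounded (\<lambda>_ _. 0)" using m_pos by simp
  have "fooling_family X jump A (tables (k - 1) m) (\<lambda>a. input (contents (\<lambda>_ _. 0) (H a)))"
    unfolding fooling_family_def
  proof (intro ballI impI)
    fix a a' assume a: "a \<in> tables (k - 1) m" "a' \<in> tables (k - 1) m" "a \<noteq> a'"
    obtain b where b: "\<forall>j x. b j x < m" "alternating (table a) b (k - 1) = 0"
      "alternating (table a') b (k - 1) = 1"
      using alternating_distinguishes[OF a m_pos] by blast
    have "iterate b (H z) (Suc (k - 1)) = alternating (table z) b (k - 1)" for z
      using it[of "k - 1" b z] by (simp add: H_def)
    hence it': "iterate b (H z) k = alternating (table z) b (k - 1)" for z
      using k_pos by (metis Suc_diff_1 gr_zeroI not_numeral_le_zero)
    have bb: "bounded b" using b(1) by simp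
    have neq: "jump (input (contents b (H a))) \<noteq> jump (input (contents b (H a')))"
      using jump_input[OF bb H[OF a(1)]] jump_input[OF bb H[OF a(2)]] it' b by simp
    have in_A: "input (contents b (H z)) x = input (contents (\<lambda>_ _. 0) (H z)) x"
      if "z \<in> tables (k - 1) m" "x \<in> A" for z x
      by (rule input_tables_cong[OF bb H[OF that(1)] zero H[OF that(1)]])
        (simp_all add: \<alpha>_poor that(2))
    have off_A: "input (contents b (H a)) x = input (contents b (H a')) x" if "x \<notin> A" for x
      by (rule input_tables_cong[OF bb H[OF a(1)] bb H[OF a(2)]]) (simp_all add: \<beta>_rich that)
    show "\<exists>\<nu>\<in>inputs X. \<exists>\<nu>'\<in>inputs X. (\<forall>x\<in>A. \<nu> x = input (contents (\<lambda>_ _. 0) (H a)) x) \<and>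
      (\<forall>x\<in>A. \<nu>' x = input (contents (\<lambda>_ _. 0) (H a')) x) \<and>
      (\<forall>x. x \<notin> A \<longrightarrow> \<nu> x = \<nu>' x) \<and> jump \<nu> \<noteq> jump \<nu>'"
      by (rule bexI[of _ "input (contents b (H a))"], rule bexI[of _ "input (contents b (H a'))"])
        (intro conjI ballI allI impI in_A off_A neq a(1,2) input_inputs; assumption)+
  qed
  thus ?thesis by blast
qed

end

section \<open>The lower bound for the jump function\<close>

context jump_function
begin

text \<open>Blocks are scanned in a fixed order, so the blocks of one half come before those of the other
  half whatever the order of the competing program is.\<close>

lemma jump_fooling:
  assumes "card (rich A) = 2 * k * m"
  shows "\<exists>enc. fooling_family X jump A (tables (k - 1) m) enc"
proof -
  let ?I = "{..<k} \<times> {..<m}" and ?K = "k * m"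
  have K: "card ?I = ?K" "finite ?I" by simp_all
  have emb: "\<exists>\<gamma>. inj_on \<gamma> ?I \<and> \<gamma> ` ?I \<subseteq> B" if "finite B" "?K \<le> card B" for B :: "nat set"
    using card_le_inj[OF K(2) that(1)] that(2) K(1) by auto
  have "rich A \<subseteq> {..<4 * ?K}" using rich_subset[of A] by (simp add: blocks_def mult.assoc)
  from balanced_halves[OF this] assms consider
      "?K \<le> card (rich A \<inter> {..<2 * ?K})" "?K \<le> card ({2 * ?K..<4 * ?K} - rich A)"
    | "?K \<le> card ({..<2 * ?K} - rich A)" "?K \<le> card (rich A \<inter> {2 * ?K..<4 * ?K})"
    by (auto simp: mult.assoc)
  thus ?thesis
  proof cases
    case 1
    obtain \<alpha> \<beta> where ab: "inj_on \<alpha> ?I" "\<alpha> ` ?I \<subseteq> rich A \<inter> {..<2 * ?K}"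
      "inj_on \<beta> ?I" "\<beta> ` ?I \<subseteq> {2 * ?K..<4 * ?K} - rich A"
      using emb[OF _ 1(1)] emb[OF _ 1(2)] by auto
    interpret jump_cut X xs k m L A \<alpha> \<beta>
      by unfold_locales (use ab in \<open>auto simp: mult.assoc\<close>)
    show ?thesis by (rule fooling_low) (use ab in auto)
  next
    case 2
    obtain \<alpha> \<beta> where ab: "inj_on \<alpha> ?I" "\<alpha> ` ?I \<subseteq> {..<2 * ?K} - rich A"
      "inj_on \<beta> ?I" "\<beta> ` ?I \<subseteq> rich A \<inter> {2 * ?K..<4 * ?K}"
      using emb[OF _ 2(1)] emb[OF _ 2(2)] by auto
    interpret jump_cut X xs k m L A \<alpha> \<beta>
      by unfold_locales (use ab in \<open>auto simp: mult.assoc\<close>)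
    show ?thesis by (rule fooling_high) (use ab in auto)
  qed
qed

lemma jump_not_k_OBDD:
  assumes W: "W + 3 \<le> m"
  shows "jump \<notin> k_OBDD X k W"
proof
  assume "jump \<in> k_OBDD X k W"
  then obtain G :: "(nat, 'x) bp" and l V \<theta> where obdd: "k_obdd X k \<theta> G l V"
    and wid: "width l V \<le> W" and comp: "computes X G jump"
    by (auto simp: k_OBDD_def)
  have dist: "distinct \<theta>" using k_obdd_distinct[OF obdd] k_pos by simp
  \<comment> \<open>Untested variables come first, so that the cut never lies behind the last level of a layer.\<close>
  obtain zs where zs: "set zs = X - set \<theta>" using finite_list[of "X - set \<theta>"] finite_X by auto
  obtain u where u: "u < length (zs @ \<theta>)"
    "card (rich (set (take u (zs @ \<theta>)))) = 2 * k * m"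
    using balanced_cut[of "zs @ \<theta>"] zs by auto
  \<comment> \<open>The subtraction truncates: if the cut falls among the untested variables, then
    \<open>?h = 0\<close> and no tested variable is in \<open>?A\<close>.\<close>
  let ?A = "set (take u (zs @ \<theta>))" and ?h = "u - length zs"
  obtain enc where enc: "fooling_family X jump ?A (tables (k - 1) m) enc"
    using jump_fooling[OF u(2)] by blast
  note fool = this[unfolded fooling_family_def, rule_format]
  have A: "\<theta> ! j \<in> ?A \<longleftrightarrow> j < ?h" if "j < length \<theta>" for j
  proof -
    have "\<theta> ! j \<notin> set zs" using zs that by simp
    hence "\<theta> ! j \<in> ?A \<longleftrightarrow> \<theta> ! j \<in> set (take ?h \<theta>)" using set_take_subset by fastforce
    also have "\<dots> \<longleftrightarrow> j < ?h"
    proof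
      assume "\<theta> ! j \<in> set (take ?h \<theta>)"
      then obtain i where "i < length \<theta>" "i < ?h" "\<theta> ! i = \<theta> ! j" by (auto simp: in_set_conv_nth)
      thus "j < ?h" using dist that nth_eq_iff_index_eq by blast
    next
      assume "j < ?h"
      thus "\<theta> ! j \<in> set (take ?h \<theta>)" using that by (auto simp: in_set_conv_nth intro!: exI[of _ j])
    qed
    finally show ?thesis .
  qed
  \<comment> \<open>The gap of 3 pays for the two reserved table entries and, using
    \<open>k \<ge> 2\<close>, for the extra exponent 1 of the first layer.\<close>
  have "(k - 1) * W + 1 \<le> (k - 1) * (m - 2)"
  proof -
    have "(k - 1) * W + 1 \<le> (k - 1) * (W + 1)" using k_pos by simp
    also have "\<dots> \<le> (k - 1) * (m - 2)" using W by (intro mult_le_mono2) simp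
    finally show ?thesis .
  qed
  hence "m ^ ((k - 1) * W + 1) \<le> m ^ ((k - 1) * (m - 2))"
    using m_pos by (intro power_increasing) auto
  moreover have "W ^ ((k - 1) * W + 1) < m ^ ((k - 1) * W + 1)"
    using W by (intro power_strict_mono) auto
  ultimately have big: "W ^ ((k - 1) * W + 1) < card (tables (k - 1) m)"
    by (simp add: card_tables)
  show False
  proof (cases "\<theta> = []")
    \<comment> \<open>There is no level to cut, but the function would be constant, which any single
      fooling pair refutes.\<close>
    case True
    have "1 < m ^ ((k - 1) * (m - 2))" using W m_pos k_pos by (intro one_less_power) auto
    hence "\<not> card (tables (k - 1) m) \<le> Suc 0" by (simp add: card_tables)
    then obtain s s' where "s \<in> tables (k - 1) m" "s' \<in> tables (k - 1) m" "s \<noteq> s'"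
      by (metis card.infinite card_le_Suc0_iff_eq le0)
    from fool[OF this] show False
      using k_obdd_empty_order[OF obdd[unfolded True] comp] by blast
  next
    case False
    have "card (tables (k - 1) m) \<le> W ^ ((k - 1) * W + 1)"
    proof (rule k_obdd_fooling_set[where enc = enc, OF obdd wid comp _ A])
      show "?h < length \<theta>" using u(1) False by (cases \<theta>) auto
      show "0 < k" using k_pos by simp
      show "fooling_family X jump ?A (tables (k - 1) m) enc" by (fact enc)
    qed
    thus False using big by simp
  qed
qed

end

section \<open>Choice of the parameters\<close>

theorem theorem1:
  fixes X :: "'x set" and n k w :: nat
  assumes "finite X" and "card X = n"
    and "2 * int k * int w *
           (2 * int w + \<lceil>log 2 (real k)\<rceil> + \<lceil>log 2 (2 * real w)\<rceil>) < int n"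
    and "k \<ge> 2" and "w \<ge> 64"
  shows "k_OBDD X k (w div 16 - 3) \<subset> k_OBDD X k w"
proof -
  define m where "m = w div 16"
  \<comment> \<open>Rounding each logarithm up gives \<open>k * (2 * w) \<le> 2 ^ L\<close>, and
    \<open>L\<close> is exactly the term in the hypothesis.\<close>
  define L where "L = nat (\<lceil>log 2 (real k)\<rceil> + \<lceil>log 2 (2 * real w)\<rceil>)"
  have m: "4 \<le> m" "16 * m \<le> w" using \<open>w \<ge> 64\<close> by (simp_all add: m_def)
  have logk: "1 \<le> log 2 (real k)" and logw: "0 \<le> log 2 (2 * real w)"
    using \<open>k \<ge> 2\<close> \<open>w \<ge> 64\<close> by (simp_all add: le_log_iff)
  have L: "int L = \<lceil>log 2 (real k)\<rceil> + \<lceil>log 2 (2 * real w)\<rceil>" "0 < L"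
  proof -
    have "1 \<le> \<lceil>log 2 (real k)\<rceil>" "0 \<le> \<lceil>log 2 (2 * real w)\<rceil>" using logk logw by linarith+
    hence pos: "0 < \<lceil>log 2 (real k)\<rceil> + \<lceil>log 2 (2 * real w)\<rceil>" by linarith
    thus "int L = \<lceil>log 2 (real k)\<rceil> + \<lceil>log 2 (2 * real w)\<rceil>" unfolding L_def by linarith
    show "0 < L" unfolding L_def zero_less_nat_eq by (rule pos)
  qed
  have "log 2 (real k * (2 * real w)) \<le> real L"
  proof -
    have "log 2 (real k * (2 * real w)) = log 2 (real k) + log 2 (2 * real w)"
      using \<open>k \<ge> 2\<close> \<open>w \<ge> 64\<close> by (simp add: log_mult)
    also have "\<dots> \<le> real_of_int \<lceil>log 2 (real k)\<rceil> + real_of_int \<lceil>log 2 (2 * real w)\<rceil>"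
      by (intro add_mono) simp_all
    also have "\<dots> = real L" using L(1) by (metis of_int_add of_int_of_nat_eq)
    finally show ?thesis .
  qed
  hence "real k * (2 * real w) \<le> 2 powr real L"
    using \<open>k \<ge> 2\<close> \<open>w \<ge> 64\<close> by (simp add: log_le_iff)
  hence "real (k * (2 * w)) \<le> real (2 ^ L)" by (simp add: powr_realpow)
  hence kw: "k * (2 * w) \<le> 2 ^ L" by (simp only: of_nat_le_iff)
  \<comment> \<open>Strictness provides the spare address code for the blocks that are never
    read.\<close>
  have "k * (2 * m) < k * (2 * w)" using m \<open>k \<ge> 2\<close> by simp
  hence code: "k * (2 * m) < 2 ^ L" using kw by linarith
  \<comment> \<open>The hypothesis on \<open>n\<close> has room for \<open>2 * k * w\<close> blocks
    of \<open>2 * w + L\<close> variables, which is ample.\<close>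
  have "(4 * k * m) * (L + (4 * m - 1)) \<le> (2 * k * w) * (2 * w + L)"
  proof (rule mult_le_mono)
    show "4 * k * m \<le> 2 * k * w"
      using m mult_le_mono2[of "4 * m" "2 * w" k] by (simp add: algebra_simps)
    show "L + (4 * m - 1) \<le> 2 * w + L" using m by simp
  qed
  also have "\<dots> \<le> card X"
  proof -
    have "int ((2 * k * w) * (2 * w + L)) < int n"
      using assms(3) L(1) by (simp add: algebra_simps)
    thus ?thesis unfolding of_nat_less_iff \<open>card X = n\<close> by (rule less_imp_le)
  qed
  finally have size: "(4 * k * m) * (L + (4 * m - 1)) \<le> card X" .
  obtain ys where ys: "set ys = X" "distinct ys" using \<open>finite X\<close> finite_distinct_list by blast
  \<comment> \<open>The function reads any sufficiently long list of distinct variables and ignores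
    the rest of \<open>X\<close>.\<close>
  define xs where "xs = take ((4 * k * m) * (L + (4 * m - 1))) ys"
  interpret jump_function X xs k m L
  proof
    show "length xs = (4 * k * m) * (L + (4 * m - 1))"
      using size ys distinct_card[OF ys(2)] by (simp add: xs_def min_def)
    show "distinct xs" "set xs \<subseteq> X" using ys by (auto simp: xs_def dest: in_set_takeD)
  qed (use \<open>finite X\<close> L(2) code m \<open>k \<ge> 2\<close> in auto)
  have "jump \<in> k_OBDD X k w" using jump_k_OBDD m by simp
  moreover have "jump \<notin> k_OBDD X k (w div 16 - 3)"
    using jump_not_k_OBDD[of "m - 3"] m by (simp add: m_def)
  moreover have "k_OBDD X k (w div 16 - 3) \<subseteq> k_OBDD X k w" by (intro k_OBDD_mono) simp
  ultimately show ?thesis by blast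
qed

end
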